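(* On a four dimensional Einstein manifold with scalar curvature $R$ and Weyl tensor $W$ we have $$\frac{1}{2}\Delta|\nabla W|^{2} = |\nabla^{2} W|^{2} + \langle \nabla W, \nabla \Delta W \rangle +\frac{R}{4}|\nabla W|^{2} + 8\, W_{ijkl,s}W_{rjkl,t}R_{rist}.$$ Equivalently, $$\frac{1}{2}\Delta|\nabla W|^{2} = |\nabla^{2} W|^{2} + \langle \nabla W, \nabla \Delta W \rangle +\frac{R}{4}|\nabla W|^{2} + 8\, W_{ijkl,s}W_{rjkl,t}W_{rist} + \frac{2}{3}R\,W_{ijkl,s}W_{sjkl,i}.$$
   Context: Manifolds are smooth and without boundary. A Riemannian manifold $(M^n,g)$ is Einstein if $\mathrm{Ric}=\lambda g$ for some constant $\lambda\in\mathbb{R}$; then $R=n\lambda$ is constant. Tensor components are taken in a local orthonormal frame $e_i$, and repeated indices are summed. With $\mathrm{R}(X,Y)Z=\nabla_X\nabla_YZ-\nabla_Y\nabla_XZ-\nabla_{[X,Y]}Z$, the $(0,4)$ Riemann tensor is $R_{ijkl}=g(e_i,\mathrm{R}(e_k,e_l)e_j)$, the Ricci tensor is $R_{ik}=R_{ijkj}$ and the scalar curvature is $R=R_{ii}$. In dimension four the Weyl tensor is $W_{ijkl}=R_{ijkl}-\frac12(R_{ik}g_{jl}-R_{il}g_{jk}+R_{jl}g_{ik}-R_{jk}g_{il})+\frac{R}{6}(g_{ik}g_{jl}-g_{il}g_{jk})$. Indices after a comma denote covariant derivatives: $T_{\ldots,pq}=\nabla_q\nabla_pT_{\ldots}$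 (and similarly for higher order, in the order in which they are written). The Laplacian is $\Delta T_{\ldots}=T_{\ldots,pp}$. Inner products and norms are full contractions: $|\nabla W|^2=W_{ijkl,s}W_{ijkl,s}$, $|\nabla^2W|^2=W_{ijkl,st}W_{ijkl,st}$, $\langle\nabla W,\nabla\Delta W\rangle=W_{ijkl,s}W_{ijkl,tts}$. *)

theory Defs
  imports "HOL-Analysis.Analysis"
begin

section \<open>Smooth manifolds\<close>

text \<open>\<open>C\<^sup>k\<close> maps on an open set: every directional derivative \<open>x \<mapsto> Df(x)v\<close> is again of class \<open>C\<^sup>k\<close>.\<close>

primrec Ck_on :: "nat \<Rightarrow> ('b::real_normed_vector \<Rightarrow> 'c::real_normed_vector) \<Rightarrow> 'b set \<Rightarrow> bool" where
  "Ck_on 0 f S \<longleftrightarrow> continuous_on S f"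
| "Ck_on (Suc k) f S \<longleftrightarrow> (\<forall>x\<in>S. f differentiable (at x)) \<and>
     (\<forall>v. Ck_on k (\<lambda>x. frechet_derivative f (at x) v) S)"

definition Cinf_on :: "('b::real_normed_vector \<Rightarrow> 'c::real_normed_vector) \<Rightarrow> 'b set \<Rightarrow> bool" where
  "Cinf_on f S \<longleftrightarrow> (\<forall>k. Ck_on k f S)"

text \<open>A chart is a pair \<open>(V, \<phi>)\<close>; since \<open>\<phi>\<close> is a total function, only its values on \<open>V\<close> matter, and
  its inverse is \<open>inv_into V \<phi>\<close>. The dimension of the manifold is \<open>CARD('n)\<close>; the atlas need not be
  maximal.\<close>

type_synonym ('a, 'n) atlas = "('a set \<times> ('a \<Rightarrow> real ^ 'n)) set"

definition smooth_manifold :: "'a topology \<Rightarrow> ('a, 'n::finite) atlas \<Rightarrow> bool" where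
  "smooth_manifold M A \<longleftrightarrow>
     Hausdorff_space M \<and> second_countable M \<and>
     (\<Union>(V, \<phi>)\<in>A. V) = topspace M \<and>
     (\<forall>(V, \<phi>)\<in>A. openin M V \<and> open (\<phi> ` V) \<and>
        homeomorphic_map (subtopology M V) (top_of_set (\<phi> ` V)) \<phi>) \<and>
     (\<forall>(V, \<phi>)\<in>A. \<forall>(V', \<phi>')\<in>A. Cinf_on (\<phi>' \<circ> inv_into V \<phi>) (\<phi> ` (V \<inter> V')))"

definition smooth_fun_on :: "'a topology \<Rightarrow> ('a, 'n::finite) atlas \<Rightarrow> 'a set \<Rightarrow> ('a \<Rightarrow> real) \<Rightarrow> bool" where
  "smooth_fun_on M A U f \<longleftrightarrow> openin M U \<and>
     (\<forall>(V, \<phi>)\<in>A. Cinf_on (f \<circ> inv_into V \<phi>) (\<phi> ` (U \<inter> V)))"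

definition smooth_near :: "'a topology \<Rightarrow> ('a, 'n::finite) atlas \<Rightarrow> 'a \<Rightarrow> ('a \<Rightarrow> real) \<Rightarrow> bool" where
  "smooth_near M A p f \<longleftrightarrow> (\<exists>U. p \<in> U \<and> smooth_fun_on M A U f)"

text \<open>Tangent vectors at \<open>p\<close> are the derivations at \<open>p\<close> of the functions that are smooth near \<open>p\<close>.
  Such a derivation \<open>v\<close> depends only on germs: if \<open>f\<close> vanishes on an open \<open>U \<ni> p\<close> and \<open>h\<close> is
  the indicator function of the complement of \<open>U\<close>, then \<open>f = f h\<close>, and the Leibniz rule gives \<open>v f = 0\<close>.
  The value \<open>0\<close> on functions that are not smooth near \<open>p\<close> makes equality of tangent vectors
  equality of functions.\<close>

type_synonym 'a tangent_vector = "('a \<Rightarrow> real) \<Rightarrow> real"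

definition tangent_space :: "'a topology \<Rightarrow> ('a, 'n::finite) atlas \<Rightarrow> 'a \<Rightarrow> 'a tangent_vector set" where
  "tangent_space M A p = {v.
     (\<forall>f h. smooth_near M A p f \<longrightarrow> smooth_near M A p h \<longrightarrow>
        v (\<lambda>q. f q + h q) = v f + v h \<and>
        v (\<lambda>q. f q * h q) = f p * v h + h p * v f) \<and>
     (\<forall>f c. smooth_near M A p f \<longrightarrow> v (\<lambda>q. c * f q) = c * v f) \<and>
     (\<forall>f. \<not> smooth_near M A p f \<longrightarrow> v f = 0)}"

type_synonym 'a vector_field = "'a \<Rightarrow> 'a tangent_vector"

definition vector_fields :: "'a topology \<Rightarrow> ('a, 'n::finite) atlas \<Rightarrow> 'a set \<Rightarrow> 'a vector_field set" where
  "vector_fields M A U = {X. (\<forall>p\<in>U. X p \<in> tangent_space M A p) \<and>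
     (\<forall>V f. V \<subseteq> U \<longrightarrow> smooth_fun_on M A V f \<longrightarrow> smooth_fun_on M A V (\<lambda>p. X p f))}"

definition lie_bracket ::
  "'a topology \<Rightarrow> ('a, 'n::finite) atlas \<Rightarrow> 'a vector_field \<Rightarrow> 'a vector_field \<Rightarrow> 'a vector_field" where
  "lie_bracket M A X Y = (\<lambda>p f. if smooth_near M A p f
     then X p (\<lambda>q. Y q f) - Y p (\<lambda>q. X q f) else 0)"

section \<open>Riemannian metrics and the Levi-Civita connection\<close>

type_synonym 'a metric = "'a \<Rightarrow> 'a tangent_vector \<Rightarrow> 'a tangent_vector \<Rightarrow> real"

definition riemannian_metric :: "'a topology \<Rightarrow> ('a, 'n::finite) atlas \<Rightarrow> 'a metric \<Rightarrow> bool" where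
  "riemannian_metric M A g \<longleftrightarrow>
     (\<forall>p\<in>topspace M.
        (\<forall>u\<in>tangent_space M A p. \<forall>v\<in>tangent_space M A p. g p u v = g p v u) \<and>
        (\<forall>u\<in>tangent_space M A p. \<forall>v\<in>tangent_space M A p. \<forall>w\<in>tangent_space M A p. \<forall>a b.
           g p (\<lambda>f. a * u f + b * v f) w = a * g p u w + b * g p v w) \<and>
        (\<forall>u\<in>tangent_space M A p. u \<noteq> (\<lambda>f. 0) \<longrightarrow> g p u u > 0)) \<and>
     (\<forall>U. openin M U \<longrightarrow> (\<forall>X\<in>vector_fields M A U. \<forall>Y\<in>vector_fields M A U.
        smooth_fun_on M A U (\<lambda>p. g p (X p) (Y p))))"

type_synonym 'a connection = "'a vector_field \<Rightarrow> 'a vector_field \<Rightarrow> 'a vector_field"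

text \<open>\<open>D X Y\<close> is the covariant derivative of \<open>Y\<close> along \<open>X\<close>, for vector fields on any open set \<open>U\<close>. The
  values of \<open>D X Y\<close> outside the domain of \<open>X\<close> and \<open>Y\<close> are unconstrained.\<close>

definition affine_connection :: "'a topology \<Rightarrow> ('a, 'n::finite) atlas \<Rightarrow> 'a connection \<Rightarrow> bool" where
  "affine_connection M A D \<longleftrightarrow> (\<forall>U. openin M U \<longrightarrow>
     (\<forall>X\<in>vector_fields M A U. \<forall>Y\<in>vector_fields M A U. D X Y \<in> vector_fields M A U) \<and>
     (\<forall>X\<in>vector_fields M A U. \<forall>Y\<in>vector_fields M A U. \<forall>Z\<in>vector_fields M A U. \<forall>p\<in>U.
        D (\<lambda>q f. X q f + Y q f) Z p = (\<lambda>f. D X Z p f + D Y Z p f) \<and>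
        D X (\<lambda>q f. Y q f + Z q f) p = (\<lambda>f. D X Y p f + D X Z p f)) \<and>
     (\<forall>X\<in>vector_fields M A U. \<forall>Y\<in>vector_fields M A U. \<forall>h. smooth_fun_on M A U h \<longrightarrow> (\<forall>p\<in>U.
        D (\<lambda>q f. h q * X q f) Y p = (\<lambda>f. h p * D X Y p f) \<and>
        D X (\<lambda>q f. h q * Y q f) p = (\<lambda>f. X p h * Y p f + h p * D X Y p f))))"

definition levi_civita_connection ::
  "'a topology \<Rightarrow> ('a, 'n::finite) atlas \<Rightarrow> 'a metric \<Rightarrow> 'a connection \<Rightarrow> bool" where
  "levi_civita_connection M A g D \<longleftrightarrow> affine_connection M A D \<and> (\<forall>U. openin M U \<longrightarrow>
     (\<forall>X\<in>vector_fields M A U. \<forall>Y\<in>vector_fields M A U. \<forall>p\<in>U.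
        (\<lambda>f. D X Y p f - D Y X p f) = lie_bracket M A X Y p) \<and>
     (\<forall>X\<in>vector_fields M A U. \<forall>Y\<in>vector_fields M A U. \<forall>Z\<in>vector_fields M A U. \<forall>p\<in>U.
        X p (\<lambda>q. g q (Y q) (Z q)) = g p (D X Y p) (Z p) + g p (Y p) (D X Z p)))"

text \<open>A local orthonormal frame on \<open>U\<close>; its index type is that of the coordinates, so it has as many
  members as the manifold has dimensions.\<close>

definition orthonormal_frame ::
  "'a topology \<Rightarrow> ('a, 'n::finite) atlas \<Rightarrow> 'a metric \<Rightarrow> 'a set \<Rightarrow> ('n \<Rightarrow> 'a vector_field) \<Rightarrow> bool" where
  "orthonormal_frame M A g U e \<longleftrightarrow> openin M U \<and> (\<forall>i. e i \<in> vector_fields M A U) \<and>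
     (\<forall>p\<in>U. (\<forall>i j. g p (e i p) (e j p) = (if i = j then 1 else 0)) \<and>
        (\<forall>v\<in>tangent_space M A p. \<exists>c. v = (\<lambda>f. \<Sum>i\<in>UNIV. c i * e i p f)))"

section \<open>Curvature\<close>

definition curvature_operator ::
  "'a topology \<Rightarrow> ('a, 'n::finite) atlas \<Rightarrow> 'a connection \<Rightarrow>
   'a vector_field \<Rightarrow> 'a vector_field \<Rightarrow> 'a vector_field \<Rightarrow> 'a vector_field" where
  "curvature_operator M A D X Y Z =
     (\<lambda>p f. D X (D Y Z) p f - D Y (D X Z) p f - D (lie_bracket M A X Y) Z p f)"

definition riemann ::
  "'a topology \<Rightarrow> ('a, 'n::finite) atlas \<Rightarrow> 'a metric \<Rightarrow> 'a connection \<Rightarrow>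
   'a vector_field \<Rightarrow> 'a vector_field \<Rightarrow> 'a vector_field \<Rightarrow> 'a vector_field \<Rightarrow> 'a \<Rightarrow> real" where
  "riemann M A g D X Y Z V = (\<lambda>p. g p (X p) (curvature_operator M A D Z V Y p))"

text \<open>The traces below are taken in a local orthonormal frame \<open>e\<close>, and are meaningful on its domain.\<close>

definition ricci ::
  "'a topology \<Rightarrow> ('a, 'n::finite) atlas \<Rightarrow> 'a metric \<Rightarrow> 'a connection \<Rightarrow> ('n \<Rightarrow> 'a vector_field) \<Rightarrow>
   'a vector_field \<Rightarrow> 'a vector_field \<Rightarrow> 'a \<Rightarrow> real" where
  "ricci M A g D e X Z = (\<lambda>p. \<Sum>j\<in>UNIV. riemann M A g D X (e j) Z (e j) p)"

definition scalar_curvature ::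
  "'a topology \<Rightarrow> ('a, 'n::finite) atlas \<Rightarrow> 'a metric \<Rightarrow> 'a connection \<Rightarrow> ('n \<Rightarrow> 'a vector_field) \<Rightarrow>
   'a \<Rightarrow> real" where
  "scalar_curvature M A g D e = (\<lambda>p. \<Sum>i\<in>UNIV. ricci M A g D e (e i) (e i) p)"

definition einstein ::
  "'a topology \<Rightarrow> ('a, 'n::finite) atlas \<Rightarrow> 'a metric \<Rightarrow> 'a connection \<Rightarrow> bool" where
  "einstein M A g D \<longleftrightarrow> (\<exists>c. \<forall>U e. orthonormal_frame M A g U e \<longrightarrow>
     (\<forall>X\<in>vector_fields M A U. \<forall>Y\<in>vector_fields M A U. \<forall>p\<in>U.
        ricci M A g D e X Y p = c * g p (X p) (Y p)))"

text \<open>The coefficients are those of dimension four.\<close>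

definition weyl4 ::
  "'a topology \<Rightarrow> ('a, 4) atlas \<Rightarrow> 'a metric \<Rightarrow> 'a connection \<Rightarrow> (4 \<Rightarrow> 'a vector_field) \<Rightarrow>
   'a vector_field \<Rightarrow> 'a vector_field \<Rightarrow> 'a vector_field \<Rightarrow> 'a vector_field \<Rightarrow> 'a \<Rightarrow> real" where
  "weyl4 M A g D e X Y Z V = (\<lambda>p.
     let Ric = (\<lambda>X Y. ricci M A g D e X Y p); G = (\<lambda>X Y. g p (X p) (Y p)) in
     riemann M A g D X Y Z V p
     - 1/2 * (Ric X Z * G Y V - Ric X V * G Y Z + Ric Y V * G X Z - Ric Y Z * G X V)
     + scalar_curvature M A g D e p / 6 * (G X Z * G Y V - G X V * G Y Z))"

section \<open>Covariant derivatives of tensors\<close>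

text \<open>A covariant tensor field of any rank is a function of a list of vector fields; a scalar function
  is the case of the empty list.\<close>

type_synonym 'a tensor = "'a vector_field list \<Rightarrow> 'a \<Rightarrow> real"

definition tensor4 ::
  "('a vector_field \<Rightarrow> 'a vector_field \<Rightarrow> 'a vector_field \<Rightarrow> 'a vector_field \<Rightarrow> 'a \<Rightarrow> real) \<Rightarrow> 'a tensor" where
  "tensor4 T = (\<lambda>Xs. T (Xs ! 0) (Xs ! 1) (Xs ! 2) (Xs ! 3))"

text \<open>The direction of differentiation is the last argument, so that iterating \<open>cov_deriv\<close> produces the
  indices after the comma in the order in which they are written.\<close>

definition cov_deriv :: "'a connection \<Rightarrow> 'a tensor \<Rightarrow> 'a tensor" where
  "cov_deriv D T Zs = (let Xs = butlast Zs; V = last Zs in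
     (\<lambda>p. V p (T Xs) - (\<Sum>i<length Xs. T (Xs[i := D V (Xs ! i)]) p)))"

definition laplacian ::
  "'a connection \<Rightarrow> ('n::finite \<Rightarrow> 'a vector_field) \<Rightarrow> 'a tensor \<Rightarrow> 'a tensor" where
  "laplacian D e T Xs = (\<lambda>p. \<Sum>m\<in>UNIV. cov_deriv D (cov_deriv D T) (Xs @ [e m, e m]) p)"

end

theory Submission
  imports Defs
begin

text \<open>
  For any tensor \<open>T\<close>, metric compatibility gives
  \<open>1/2 \<Delta>|\<nabla>T|\<^sup>2 = |\<nabla>\<^sup>2T|\<^sup>2 + \<langle>\<nabla>T, \<Delta>\<nabla>T\<rangle>\<close>, so everything hinges on commuting \<open>\<Delta>\<close> and \<open>\<nabla>\<close>.
  Passing from \<open>T\<^bsub>,stt\<^esub>\<close> through \<open>T\<^bsub>,tst\<^esub>\<close> to \<open>T\<^bsub>,tts\<^esub>\<close> takes two applications of the Ricci identity. Each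
  produces, for every slot \<open>i\<close> of \<open>T\<close>, a term \<open>R\<^bsub>rist\<^esub> T\<^bsub>..r..,t\<^esub>\<close>; the second one also acts on the derivative
  index and yields a Ricci term, that is \<open>(R/4) T\<^bsub>,s\<^esub>\<close>; the first one, being differentiated in the direction
  \<open>t\<close>, yields the divergence of the curvature, which vanishes on Einstein manifolds by the second
  Bianchi identity. For \<open>T = W\<close> the four slots contribute equally by the symmetries of \<open>\<nabla>W\<close>, hence
  the factor \<open>8\<close>. Finally \<open>R\<^bsub>rist\<^esub>\<close> and \<open>W\<^bsub>rist\<^esub>\<close> differ by \<open>(R/12) (g\<^bsub>rs\<^esub> g\<^bsub>it\<^esub> - g\<^bsub>rt\<^esub> g\<^bsub>is\<^esub>)\<close>, whose second part
  contributes the square of the divergence of \<open>W\<close>, which is zero.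
\<close>

section \<open>Smooth functions, vector fields and the connection on an open set\<close>

text \<open>Since \<open>S\<close> is open, agreement on \<open>S\<close> is agreement near each of
  its points, so the Frechet derivatives agree on \<open>S\<close> too and the induction passes to
  them. This allows a derivative to be replaced by the formula that computes it on
  \<open>S\<close>.\<close>

lemma Ck_on_cong:
  assumes "open S" "\<And>x. x \<in> S \<Longrightarrow> f x = h x" "Ck_on k f S"
  shows "Ck_on k h S"
  using assms(2,3)
proof (induction k arbitrary: f h)
  case 0
  then show ?case by (simp cong: continuous_on_cong)
next
  case (Suc k)
  have der: "(h has_derivative F) (at x)" if "(f has_derivative F) (at x)" "x \<in> S" for F x
    using has_derivative_transform_within_open[OF that(1) assms(1) that(2)] Suc.prems(1) by blast
  have fr: "frechet_derivative f (at x) = frechet_derivative h (at x)" if "x \<in> S" for x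
  proof -
    have "(f has_derivative frechet_derivative f (at x)) (at x)"
      using Suc.prems(2) that by (simp add: frechet_derivative_works)
    from frechet_derivative_at[OF der[OF this that]] show ?thesis .
  qed
  have "h differentiable (at x)" if "x \<in> S" for x
    using Suc.prems(2) that der[OF _ that] unfolding differentiable_def by (metis Ck_on.simps(2) differentiable_def)
  moreover have "Ck_on k (\<lambda>x. frechet_derivative h (at x) v) S" for v
    using Suc.IH[of "\<lambda>x. frechet_derivative f (at x) v" "\<lambda>x. frechet_derivative h (at x) v"]
      Suc.prems(2) fr by simp
  ultimately show ?case by simp
qed

lemma Ck_on_subset: "Ck_on k f S \<Longrightarrow> S' \<subseteq> S \<Longrightarrow> Ck_on k f S'"
  by (induction k arbitrary: f) (auto intro: continuous_on_subset)

text \<open>The base case is continuity of differentiable maps. The product rule needs this, because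
  it leaves one factor undifferentiated in each term.\<close>

lemma Ck_on_Suc_D: "Ck_on (Suc k) f S \<Longrightarrow> Ck_on k f S"
proof (induction k arbitrary: f)
  case 0
  then show ?case
    by (auto simp: continuous_on_eq_continuous_within
      intro: differentiable_imp_continuous_within differentiable_at_withinI)
next
  case (Suc k)
  then show ?case by (metis Ck_on.simps(2))
qed

lemma Ck_on_const: "Ck_on k (\<lambda>x. c) S"
  by (induction k arbitrary: c) auto

lemma Ck_on_add:
  fixes f h :: "'b::real_normed_vector \<Rightarrow> 'c::real_normed_vector"
  assumes "open S" "Ck_on k f S" "Ck_on k h S"
  shows "Ck_on k (\<lambda>x. f x + h x) S"
  using assms(2,3)
proof (induction k arbitrary: f h)
  case 0
  then show ?case by (simp add: continuous_on_add)
next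
  case (Suc k)
  have der: "((\<lambda>x. f x + h x) has_derivative
      (\<lambda>v. frechet_derivative f (at x) v + frechet_derivative h (at x) v)) (at x)" if "x \<in> S" for x
    using Suc.prems that by (auto intro!: has_derivative_add simp: frechet_derivative_works[symmetric])
  have "Ck_on k (\<lambda>x. frechet_derivative (\<lambda>x. f x + h x) (at x) v) S" for v
  proof (rule Ck_on_cong[OF assms(1)])
    show "Ck_on k (\<lambda>x. frechet_derivative f (at x) v + frechet_derivative h (at x) v) S"
      using Suc by simp
  qed (simp add: frechet_derivative_at[OF der, symmetric])
  then show ?case using der by (auto simp: differentiable_def)
qed

lemma Ck_on_mult:
  fixes f h :: "'b::real_normed_vector \<Rightarrow> real"
  assumes "open S" "Ck_on k f S" "Ck_on k h S"
  shows "Ck_on k (\<lambda>x. f x * h x) S"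
  using assms(2,3)
proof (induction k arbitrary: f h)
  case 0
  then show ?case by (simp add: continuous_on_mult)
next
  case (Suc k)
  have der: "((\<lambda>x. f x * h x) has_derivative
      (\<lambda>v. f x * frechet_derivative h (at x) v + frechet_derivative f (at x) v * h x)) (at x)"
    if "x \<in> S" for x
    using Suc.prems that by (auto intro!: has_derivative_mult simp: frechet_derivative_works[symmetric])
  have "Ck_on k (\<lambda>x. frechet_derivative (\<lambda>x. f x * h x) (at x) v) S" for v
  proof (rule Ck_on_cong[OF assms(1)])
    show "Ck_on k (\<lambda>x. f x * frechet_derivative h (at x) v + frechet_derivative f (at x) v * h x) S"
      using Suc.IH[of f "\<lambda>x. frechet_derivative h (at x) v"]
        Suc.IH[of "\<lambda>x. frechet_derivative f (at x) v" h] Suc.prems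
        Ck_on_Suc_D[OF Suc.prems(1)] Ck_on_Suc_D[OF Suc.prems(2)]
      by (intro Ck_on_add[OF assms(1)]) auto
  qed (simp add: frechet_derivative_at[OF der, symmetric])
  then show ?case using der by (auto simp: differentiable_def)
qed

section \<open>Smooth real functions on open subsets of a manifold\<close>

locale manifold =
  fixes M :: "'a topology" and A :: "('a, 'n::finite) atlas"
  assumes smooth_manifold: "smooth_manifold M A"
begin

lemma chart:
  assumes "(V, \<phi>) \<in> A"
  shows "openin M V" "open (\<phi> ` V)"
    "homeomorphic_map (subtopology M V) (top_of_set (\<phi> ` V)) \<phi>"
  using smooth_manifold assms unfolding smooth_manifold_def by auto

lemma inj_on_chart: "(V, \<phi>) \<in> A \<Longrightarrow> inj_on \<phi> V"
  using homeomorphic_imp_injective_map[OF chart(3)] openin_subset[OF chart(1)]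
  by (metis topspace_subtopology_subset)

text \<open>A chart is an open map onto its image, and that image is itself open in the coordinate
  space. The calculus lemmas above need this openness.\<close>

lemma open_chart_image:
  assumes "(V, \<phi>) \<in> A" "openin M S"
  shows "open (\<phi> ` (S \<inter> V))"
proof -
  have "openin (subtopology M V) (S \<inter> V)"
    using assms(2) by (auto simp: openin_subtopology)
  then have "openin (top_of_set (\<phi> ` V)) (\<phi> ` (S \<inter> V))"
    using homeomorphic_imp_open_map[OF chart(3)[OF assms(1)]] by (auto simp: open_map_def)
  then show ?thesis
    using chart(2)[OF assms(1)] openin_open_trans by blast
qed

lemma smooth_openin: "smooth_fun_on M A S f \<Longrightarrow> openin M S"
  by (simp add: smooth_fun_on_def)

lemma smooth_cong:
  assumes "smooth_fun_on M A S f" "\<And>q. q \<in> S \<Longrightarrow> f q = h q"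
  shows "smooth_fun_on M A S h"
  unfolding smooth_fun_on_def
proof (intro conjI ballI)
  show "openin M S" using assms(1) by (rule smooth_openin)
  fix c assume "c \<in> A"
  moreover obtain V \<phi> where c: "c = (V, \<phi>)" by fastforce
  ultimately have VA: "(V, \<phi>) \<in> A" by simp
  have "Ck_on k (f \<circ> inv_into V \<phi>) (\<phi> ` (S \<inter> V))" for k
    using assms(1) VA unfolding smooth_fun_on_def Cinf_on_def by auto
  then have "Ck_on k (h \<circ> inv_into V \<phi>) (\<phi> ` (S \<inter> V))" for k
    by (rule Ck_on_cong[OF open_chart_image[OF VA smooth_openin[OF assms(1)]], rotated])
      (auto simp: inv_into_f_f[OF inj_on_chart[OF VA]] assms(2))
  then show "case c of (V, \<phi>) \<Rightarrow> Cinf_on (h \<circ> inv_into V \<phi>) (\<phi> ` (S \<inter> V))"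
    by (simp add: c Cinf_on_def)
qed

lemma smooth_iff:
  "smooth_fun_on M A S f \<longleftrightarrow> openin M S \<and>
    (\<forall>V \<phi> k. (V, \<phi>) \<in> A \<longrightarrow> Ck_on k (\<lambda>x. f (inv_into V \<phi> x)) (\<phi> ` (S \<inter> V)))"
  unfolding smooth_fun_on_def Cinf_on_def comp_def by (simp add: Ball_def split_paired_All)

lemma smooth_subset:
  assumes "smooth_fun_on M A S f" "openin M S'" "S' \<subseteq> S"
  shows "smooth_fun_on M A S' f"
  unfolding smooth_iff
proof (intro conjI allI impI)
  fix V \<phi> k assume "(V, \<phi>) \<in> A"
  then have "Ck_on k (\<lambda>x. f (inv_into V \<phi> x)) (\<phi> ` (S \<inter> V))"
    using assms(1) by (simp add: smooth_iff)
  then show "Ck_on k (\<lambda>x. f (inv_into V \<phi> x)) (\<phi> ` (S' \<inter> V))"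
    by (rule Ck_on_subset) (use assms(3) in blast)
qed (rule assms(2))

lemma smooth_const: "openin M S \<Longrightarrow> smooth_fun_on M A S (\<lambda>q. c)"
  by (simp add: smooth_iff Ck_on_const)

lemma smooth_add:
  "smooth_fun_on M A S f \<Longrightarrow> smooth_fun_on M A S h \<Longrightarrow> smooth_fun_on M A S (\<lambda>q. f q + h q)"
  by (simp add: smooth_iff open_chart_image Ck_on_add)

lemma smooth_mult:
  "smooth_fun_on M A S f \<Longrightarrow> smooth_fun_on M A S h \<Longrightarrow> smooth_fun_on M A S (\<lambda>q. f q * h q)"
  by (simp add: smooth_iff open_chart_image Ck_on_mult)

lemma smooth_cmult: "smooth_fun_on M A S f \<Longrightarrow> smooth_fun_on M A S (\<lambda>q. c * f q)"
  using smooth_mult[OF smooth_const] smooth_openin by blast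

lemma smooth_uminus: "smooth_fun_on M A S f \<Longrightarrow> smooth_fun_on M A S (\<lambda>q. - f q)"
  using smooth_cmult[of S f "-1"] by simp

lemma smooth_diff:
  "smooth_fun_on M A S f \<Longrightarrow> smooth_fun_on M A S h \<Longrightarrow> smooth_fun_on M A S (\<lambda>q. f q - h q)"
  using smooth_add[OF _ smooth_uminus, of S f h] by simp

lemma smooth_sum:
  assumes "openin M S" "\<And>i. i \<in> I \<Longrightarrow> smooth_fun_on M A S (f i)"
  shows "smooth_fun_on M A S (\<lambda>q. \<Sum>i\<in>I. f i q)"
  using assms(2)
  by (induction I rule: infinite_finite_induct) (auto intro: smooth_const assms(1) smooth_add)

text \<open>On \<open>S\<close> it is the constant 1, and smoothness over \<open>S\<close> ignores
  all other values. Multiplication by it turns agreement on \<open>S\<close> into equality of total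
  functions.\<close>

lemma smooth_indicator: "openin M S \<Longrightarrow> smooth_fun_on M A S (indicator S)"
  by (rule smooth_cong[OF smooth_const[of S 1]]) auto

lemma smooth_nearI: "smooth_fun_on M A S f \<Longrightarrow> q \<in> S \<Longrightarrow> smooth_near M A q f"
  unfolding smooth_near_def by blast

section \<open>Tangent vectors as local derivations\<close>

lemma tangent_add:
  assumes "v \<in> tangent_space M A q" "q \<in> S" "smooth_fun_on M A S f" "smooth_fun_on M A S h"
  shows "v (\<lambda>r. f r + h r) = v f + v h"
  using assms smooth_nearI[OF assms(3,2)] smooth_nearI[OF assms(4,2)]
  unfolding tangent_space_def by blast

lemma tangent_mult:
  assumes "v \<in> tangent_space M A q" "q \<in> S" "smooth_fun_on M A S f" "smooth_fun_on M A S h"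
  shows "v (\<lambda>r. f r * h r) = f q * v h + h q * v f"
  using assms smooth_nearI[OF assms(3,2)] smooth_nearI[OF assms(4,2)]
  unfolding tangent_space_def by blast

lemma tangent_cmult:
  assumes "v \<in> tangent_space M A q" "q \<in> S" "smooth_fun_on M A S f"
  shows "v (\<lambda>r. c * f r) = c * v f"
  using assms smooth_nearI[OF assms(3,2)] unfolding tangent_space_def by blast

text \<open>The indicator function is idempotent and takes the value 1 at \<open>q\<close>, so the
  Leibniz rule says that \<open>v (indicator S)\<close> equals twice itself.\<close>

lemma tangent_indicator:
  assumes "v \<in> tangent_space M A q" "q \<in> S" "openin M S"
  shows "v (indicator S) = 0"
proof -
  have "(\<lambda>r. indicator S r * indicator S r) = (indicator S :: 'a \<Rightarrow> real)"
    by (auto simp: indicator_def)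
  then show ?thesis
    using tangent_mult[OF assms(1,2) smooth_indicator[OF assms(3)] smooth_indicator[OF assms(3)]]
      assms(2) by simp
qed

text \<open>By the Leibniz rule and \<open>tangent_indicator\<close>, multiplying by the indicator
  function of \<open>S\<close> does not change the value of \<open>v\<close>; after that
  multiplication \<open>f\<close> and \<open>h\<close> are the same function.\<close>

lemma tangent_cong:
  assumes v: "v \<in> tangent_space M A q" and q: "q \<in> S" and f: "smooth_fun_on M A S f"
    and eq: "\<And>r. r \<in> S \<Longrightarrow> f r = h r"
  shows "v f = v h"
proof -
  note S = smooth_openin[OF f] and h = smooth_cong[OF f eq]
  have "v (\<lambda>r. indicator S r * k r) = v k" if "smooth_fun_on M A S k" for k
    using tangent_mult[OF v q smooth_indicator[OF S] that] tangent_indicator[OF v q S] q by simp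
  moreover have "(\<lambda>r. indicator S r * f r) = (\<lambda>r. indicator S r * h r)"
    using eq by (auto simp: indicator_def)
  ultimately show ?thesis using f h by metis
qed

lemma tangent_const:
  assumes "v \<in> tangent_space M A q" "q \<in> S" "openin M S"
  shows "v (\<lambda>r. c) = 0"
proof -
  have "v (\<lambda>r. c) = v (\<lambda>r. c * indicator S r)"
    by (rule tangent_cong[OF assms(1,2) smooth_const[OF assms(3)]]) simp
  then show ?thesis
    using tangent_cmult[OF assms(1,2) smooth_indicator[OF assms(3)]] tangent_indicator[OF assms]
    by simp
qed

lemma tangent_uminus:
  assumes "v \<in> tangent_space M A q" "q \<in> S" "smooth_fun_on M A S f"
  shows "v (\<lambda>r. - f r) = - v f"
  using tangent_cmult[OF assms, of "-1"] by simp

lemma tangent_diff: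
  assumes "v \<in> tangent_space M A q" "q \<in> S" "smooth_fun_on M A S f" "smooth_fun_on M A S h"
  shows "v (\<lambda>r. f r - h r) = v f - v h"
  using tangent_add[OF assms(1,2,3) smooth_uminus[OF assms(4)]] tangent_uminus[OF assms(1,2,4)]
  by simp

lemma tangent_sum:
  assumes "v \<in> tangent_space M A q" "q \<in> S" "openin M S"
    and "\<And>i. i \<in> I \<Longrightarrow> smooth_fun_on M A S (f i)"
  shows "v (\<lambda>r. \<Sum>i\<in>I. f i r) = (\<Sum>i\<in>I. v (f i))"
  using assms(4)
proof (induction I rule: infinite_finite_induct)
  case (insert i I)
  then show ?case
    using tangent_add[OF assms(1,2), of "f i" "\<lambda>r. \<Sum>i\<in>I. f i r"] smooth_sum[OF assms(3), of I f]
    by simp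
qed (auto intro: tangent_const[OF assms(1-3)])

lemma tangent_space_add:
  "u \<in> tangent_space M A q \<Longrightarrow> v \<in> tangent_space M A q \<Longrightarrow> (\<lambda>f. u f + v f) \<in> tangent_space M A q"
  unfolding tangent_space_def by (auto simp: algebra_simps)

lemma tangent_space_cmult:
  "u \<in> tangent_space M A q \<Longrightarrow> (\<lambda>f. c * u f) \<in> tangent_space M A q"
  unfolding tangent_space_def by (auto simp: algebra_simps)

end

section \<open>Vector fields, connection and Lie bracket over a fixed open set\<close>

locale levi_civita = manifold M A for M :: "'a topology" and A :: "('a, 'n::finite) atlas" +
  fixes g :: "'a metric" and D :: "'a connection" and U :: "'a set"
  assumes metric: "riemannian_metric M A g"
    and connection: "levi_civita_connection M A g D"
    and openU: "openin M U"
begin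

abbreviation VF where "VF \<equiv> vector_fields M A U"
abbreviation smooth where "smooth \<equiv> smooth_fun_on M A U"
abbreviation bracket where "bracket \<equiv> lie_bracket M A"
abbreviation curv where "curv \<equiv> curvature_operator M A D"

lemma VF_tangent: "X \<in> VF \<Longrightarrow> q \<in> U \<Longrightarrow> X q \<in> tangent_space M A q"
  by (simp add: vector_fields_def)

lemma VF_smooth_on: "X \<in> VF \<Longrightarrow> S \<subseteq> U \<Longrightarrow> smooth_fun_on M A S f \<Longrightarrow> smooth_fun_on M A S (\<lambda>q. X q f)"
  by (simp add: vector_fields_def)

lemma VF_smooth: "X \<in> VF \<Longrightarrow> smooth f \<Longrightarrow> smooth (\<lambda>q. X q f)"
  by (simp add: VF_smooth_on)

lemma VFI:
  assumes "\<And>q. q \<in> U \<Longrightarrow> X q \<in> tangent_space M A q"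
    and "\<And>S f. S \<subseteq> U \<Longrightarrow> smooth_fun_on M A S f \<Longrightarrow> smooth_fun_on M A S (\<lambda>q. X q f)"
  shows "X \<in> VF"
  using assms by (simp add: vector_fields_def)

lemma VF_cong:
  assumes "X \<in> VF" "\<And>q. q \<in> U \<Longrightarrow> X q = Y q" shows "Y \<in> VF"
proof (rule VFI)
  fix q assume "q \<in> U" then show "Y q \<in> tangent_space M A q"
    using assms VF_tangent[of X q] by simp
next
  fix S f assume S: "S \<subseteq> U" "smooth_fun_on M A S f"
  show "smooth_fun_on M A S (\<lambda>q. Y q f)"
    by (rule smooth_cong[OF VF_smooth_on[OF assms(1) S]]) (use S assms in auto)
qed

lemma VF_add: "X \<in> VF \<Longrightarrow> Y \<in> VF \<Longrightarrow> (\<lambda>q f. X q f + Y q f) \<in> VF"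
  by (rule VFI) (simp_all add: tangent_space_add smooth_add VF_tangent VF_smooth_on)

lemma VF_scale:
  assumes "smooth h" "X \<in> VF" shows "(\<lambda>q f. h q * X q f) \<in> VF"
proof (rule VFI)
  fix S f assume S: "S \<subseteq> U" "smooth_fun_on M A S f"
  show "smooth_fun_on M A S (\<lambda>q. h q * X q f)"
    by (rule smooth_mult[OF smooth_subset[OF assms(1) smooth_openin[OF S(2)] S(1)]
      VF_smooth_on[OF assms(2) S]])
qed (simp add: tangent_space_cmult VF_tangent assms(2))

lemma VF_uminus: "X \<in> VF \<Longrightarrow> (\<lambda>q f. - X q f) \<in> VF"
  using VF_scale[OF smooth_const[OF openU, of "-1"]] by simp

lemma VF_diff: "X \<in> VF \<Longrightarrow> Y \<in> VF \<Longrightarrow> (\<lambda>q f. X q f - Y q f) \<in> VF"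
  using VF_add[OF _ VF_uminus, of X Y] by simp

lemma VF_zero: "(\<lambda>q f. 0) \<in> VF"
  by (rule VFI) (auto simp: tangent_space_def dest: smooth_openin intro: smooth_const)

lemma VF_sum:
  "(\<And>i. i \<in> I \<Longrightarrow> X i \<in> VF) \<Longrightarrow> (\<lambda>q f. \<Sum>i\<in>I. X i q f) \<in> VF"
  by (induction I rule: infinite_finite_induct) (auto intro: VF_zero VF_add)

lemmas apply_add = tangent_add[OF VF_tangent]
  and apply_mult = tangent_mult[OF VF_tangent]
  and apply_cmult = tangent_cmult[OF VF_tangent]
  and apply_diff = tangent_diff[OF VF_tangent]
  and apply_uminus = tangent_uminus[OF VF_tangent]
  and apply_cong = tangent_cong[OF VF_tangent]

lemma apply_sum:
  "X \<in> VF \<Longrightarrow> q \<in> U \<Longrightarrow> (\<And>i. i \<in> I \<Longrightarrow> smooth (f i)) \<Longrightarrow>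
    X q (\<lambda>r. \<Sum>i\<in>I. f i r) = (\<Sum>i\<in>I. X q (f i))"
  by (rule tangent_sum[OF VF_tangent _ openU])

lemma affine: "affine_connection M A D"
  using connection by (simp add: levi_civita_connection_def)

lemmas affine_U = affine[unfolded affine_connection_def, rule_format, OF openU]

lemma VF_D: "X \<in> VF \<Longrightarrow> Y \<in> VF \<Longrightarrow> D X Y \<in> VF"
  using conjunct1[OF affine_U] by blast

lemma D_add_left:
  "X \<in> VF \<Longrightarrow> Y \<in> VF \<Longrightarrow> Z \<in> VF \<Longrightarrow> q \<in> U \<Longrightarrow> D (\<lambda>q f. X q f + Y q f) Z q = (\<lambda>f. D X Z q f + D Y Z q f)"
  using conjunct1[OF conjunct2[OF affine_U]] by blast

lemma D_add_right:
  "X \<in> VF \<Longrightarrow> Y \<in> VF \<Longrightarrow> Z \<in> VF \<Longrightarrow> q \<in> U \<Longrightarrow> D X (\<lambda>q f. Y q f + Z q f) q = (\<lambda>f. D X Y q f + D X Z q f)"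
  using conjunct1[OF conjunct2[OF affine_U]] by blast

lemma D_scale_left:
  "smooth h \<Longrightarrow> X \<in> VF \<Longrightarrow> Y \<in> VF \<Longrightarrow> q \<in> U \<Longrightarrow> D (\<lambda>q f. h q * X q f) Y q = (\<lambda>f. h q * D X Y q f)"
  using conjunct2[OF conjunct2[OF affine_U]] by blast

lemma D_scale_right:
  "smooth h \<Longrightarrow> X \<in> VF \<Longrightarrow> Y \<in> VF \<Longrightarrow> q \<in> U \<Longrightarrow>
    D X (\<lambda>q f. h q * Y q f) q = (\<lambda>f. X q h * Y q f + h q * D X Y q f)"
  using conjunct2[OF conjunct2[OF affine_U]] by blast

text \<open>Multiplying by the indicator function of \<open>U\<close> turns agreement on \<open>U\<close> into equality of
  functions, so tensoriality yields locality.\<close>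

lemma D_cong:
  assumes "X \<in> VF" "X' \<in> VF" "Y \<in> VF" "Y' \<in> VF" "q \<in> U"
    and eq: "\<And>r. r \<in> U \<Longrightarrow> X r = X' r" "\<And>r. r \<in> U \<Longrightarrow> Y r = Y' r"
  shows "D X Y q = D X' Y' q"
proof -
  let ?h = "indicator U :: 'a \<Rightarrow> real"
  have eq': "(\<lambda>r f. ?h r * X r f) = (\<lambda>r f. ?h r * X' r f)"
    "(\<lambda>r f. ?h r * Y r f) = (\<lambda>r f. ?h r * Y' r f)"
    using eq by (auto simp: indicator_def fun_eq_iff)
  note h = smooth_indicator[OF openU]
  have "D X Y q = D (\<lambda>r f. ?h r * X r f) Y q"
    using D_scale_left[OF h assms(1,3,5)] assms(5) by simp
  also have "\<dots> = D X' Y q"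
    using D_scale_left[OF h assms(2,3,5)] assms(5) eq' by simp
  also have "\<dots> = D X' (\<lambda>r f. ?h r * Y r f) q"
    using D_scale_right[OF h assms(2,3,5)] assms(5)
      tangent_indicator[OF VF_tangent[OF assms(2,5)] assms(5) openU] by simp
  also have "\<dots> = D X' Y' q"
    using D_scale_right[OF h assms(2,4,5)] assms(5)
      tangent_indicator[OF VF_tangent[OF assms(2,5)] assms(5) openU] eq' by simp
  finally show ?thesis .
qed

lemma D_uminus_left:
  "X \<in> VF \<Longrightarrow> Y \<in> VF \<Longrightarrow> q \<in> U \<Longrightarrow> D (\<lambda>q f. - X q f) Y q = (\<lambda>f. - D X Y q f)"
  using D_scale_left[OF smooth_const[OF openU, of "-1"]] by simp

lemma D_uminus_right:
  "X \<in> VF \<Longrightarrow> Y \<in> VF \<Longrightarrow> q \<in> U \<Longrightarrow> D X (\<lambda>q f. - Y q f) q = (\<lambda>f. - D X Y q f)"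
  using D_scale_right[OF smooth_const[OF openU, of "-1"], of X Y q]
    tangent_const[OF VF_tangent _ openU, of X q "-1"]
  by simp

lemma D_diff_left:
  "X \<in> VF \<Longrightarrow> Y \<in> VF \<Longrightarrow> Z \<in> VF \<Longrightarrow> q \<in> U \<Longrightarrow> D (\<lambda>q f. X q f - Y q f) Z q = (\<lambda>f. D X Z q f - D Y Z q f)"
  using D_add_left[of X "\<lambda>q f. - Y q f" Z q] VF_uminus[of Y] D_uminus_left[of Y Z q] by simp

lemma D_diff_right:
  "X \<in> VF \<Longrightarrow> Y \<in> VF \<Longrightarrow> Z \<in> VF \<Longrightarrow> q \<in> U \<Longrightarrow> D X (\<lambda>q f. Y q f - Z q f) q = (\<lambda>f. D X Y q f - D X Z q f)"
  using D_add_right[of X Y "\<lambda>q f. - Z q f" q] VF_uminus[of Z] D_uminus_right[of X Z q] by simp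

lemmas connection_U = conjunct2[OF connection[unfolded levi_civita_connection_def], rule_format, OF openU]

lemma bracket_eq:
  "X \<in> VF \<Longrightarrow> Y \<in> VF \<Longrightarrow> q \<in> U \<Longrightarrow> bracket X Y q = (\<lambda>f. D X Y q f - D Y X q f)"
  using conjunct1[OF connection_U] by metis

lemma VF_bracket: "X \<in> VF \<Longrightarrow> Y \<in> VF \<Longrightarrow> bracket X Y \<in> VF"
  by (rule VF_cong[OF VF_diff[OF VF_D VF_D, of X Y Y X]]) (auto simp: bracket_eq)

lemma bracket_apply:
  "smooth_fun_on M A S f \<Longrightarrow> q \<in> S \<Longrightarrow>
    bracket X Y q f = X q (\<lambda>r. Y r f) - Y q (\<lambda>r. X r f)"
  by (simp add: lie_bracket_def smooth_nearI)

text \<open>Expanding the double brackets gives twelve third-order terms that cancel in pairs. If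
  \<open>f\<close> is not smooth near \<open>q\<close>, every bracket takes its default value 0 on
  \<open>f\<close>.\<close>

lemma jacobi:
  assumes XYZ: "X \<in> VF" "Y \<in> VF" "Z \<in> VF" and q: "q \<in> U"
  shows "bracket X (bracket Y Z) q f + bracket Y (bracket Z X) q f + bracket Z (bracket X Y) q f = 0"
proof (cases "smooth_near M A q f")
  case True
  then obtain S' where S': "q \<in> S'" "smooth_fun_on M A S' f" by (auto simp: smooth_near_def)
  \<comment> \<open>\<open>f\<close> is smooth only near \<open>q\<close>, perhaps not on all of
    \<open>U\<close>; on the smaller set \<open>S\<close> both \<open>f\<close> and its derivatives
    along the fields are smooth.\<close>
  define S where "S = S' \<inter> U"
  have S: "q \<in> S" "S \<subseteq> U" "smooth_fun_on M A S f"
    using S' q openU smooth_subset[OF S'(2), of S] smooth_openin[OF S'(2)] by (auto simp: S_def)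
  have expand: "bracket X (bracket Y Z) q f =
      X q (\<lambda>r. Y r (\<lambda>r. Z r f)) - X q (\<lambda>r. Z r (\<lambda>r. Y r f))
      - (Y q (\<lambda>r. Z r (\<lambda>r. X r f)) - Z q (\<lambda>r. Y r (\<lambda>r. X r f)))"
    if "X \<in> VF" "Y \<in> VF" "Z \<in> VF" for X Y Z
  proof -
    note sm = VF_smooth_on[OF _ S(2)]
    have "X q (\<lambda>r. bracket Y Z r f) = X q (\<lambda>r. Y r (\<lambda>r. Z r f) - Z r (\<lambda>r. Y r f))"
      by (rule tangent_cong[OF VF_tangent[OF that(1) q] S(1)])
        (use that S sm VF_bracket bracket_apply[OF S(3)] in auto)
    also have "\<dots> = X q (\<lambda>r. Y r (\<lambda>r. Z r f)) - X q (\<lambda>r. Z r (\<lambda>r. Y r f))"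
      by (rule tangent_diff[OF VF_tangent[OF that(1) q] S(1)]) (use that S sm in auto)
    finally show ?thesis
      using bracket_apply[OF sm[OF that(1) S(3)] S(1)] bracket_apply[OF S(3,1)] by simp
  qed
  show ?thesis using XYZ by (simp add: expand)
qed (simp add: lie_bracket_def)

section \<open>Pointwise rules for the metric\<close>

lemma metric_sym:
  "X \<in> VF \<Longrightarrow> Y \<in> VF \<Longrightarrow> q \<in> U \<Longrightarrow> g q (X q) (Y q) = g q (Y q) (X q)"
  using metric openin_subset[OF openU] VF_tangent unfolding riemannian_metric_def by blast

lemma metric_lin:
  assumes "X \<in> VF" "Y \<in> VF" "Z \<in> VF" "q \<in> U"
  shows "g q (\<lambda>f. a * X q f + b * Y q f) (Z q) = a * g q (X q) (Z q) + b * g q (Y q) (Z q)"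
  using assms metric openin_subset[OF openU] VF_tangent unfolding riemannian_metric_def by blast

lemma metric_smooth: "X \<in> VF \<Longrightarrow> Y \<in> VF \<Longrightarrow> smooth (\<lambda>q. g q (X q) (Y q))"
  using metric openU unfolding riemannian_metric_def by blast

lemma metric_add_left:
  "X \<in> VF \<Longrightarrow> Y \<in> VF \<Longrightarrow> Z \<in> VF \<Longrightarrow> q \<in> U \<Longrightarrow>
    g q (\<lambda>f. X q f + Y q f) (Z q) = g q (X q) (Z q) + g q (Y q) (Z q)"
  using metric_lin[of X Y Z q 1 1] by simp

lemma metric_diff_left:
  "X \<in> VF \<Longrightarrow> Y \<in> VF \<Longrightarrow> Z \<in> VF \<Longrightarrow> q \<in> U \<Longrightarrow>
    g q (\<lambda>f. X q f - Y q f) (Z q) = g q (X q) (Z q) - g q (Y q) (Z q)"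
  using metric_lin[of X Y Z q 1 "-1"] by simp

lemma metric_scale_left:
  "X \<in> VF \<Longrightarrow> Z \<in> VF \<Longrightarrow> q \<in> U \<Longrightarrow> g q (\<lambda>f. c * X q f) (Z q) = c * g q (X q) (Z q)"
  using metric_lin[of X X Z q c 0] by simp

lemma metric_add_right:
  "X \<in> VF \<Longrightarrow> Y \<in> VF \<Longrightarrow> Z \<in> VF \<Longrightarrow> q \<in> U \<Longrightarrow>
    g q (Z q) (\<lambda>f. X q f + Y q f) = g q (Z q) (X q) + g q (Z q) (Y q)"
  using metric_add_left[of X Y Z q] metric_sym[OF VF_add[of X Y], of Z q]
    metric_sym[of X Z q] metric_sym[of Y Z q] by simp

lemma metric_diff_right:
  "X \<in> VF \<Longrightarrow> Y \<in> VF \<Longrightarrow> Z \<in> VF \<Longrightarrow> q \<in> U \<Longrightarrow>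
    g q (Z q) (\<lambda>f. X q f - Y q f) = g q (Z q) (X q) - g q (Z q) (Y q)"
  using metric_diff_left[of X Y Z q] metric_sym[OF VF_diff[of X Y], of Z q]
    metric_sym[of X Z q] metric_sym[of Y Z q] by simp

lemma metric_compat:
  "X \<in> VF \<Longrightarrow> Y \<in> VF \<Longrightarrow> Z \<in> VF \<Longrightarrow> q \<in> U \<Longrightarrow>
    X q (\<lambda>r. g r (Y r) (Z r)) = g q (D X Y q) (Z q) + g q (Y q) (D X Z q)"
  using conjunct2[OF connection_U] by blast

end

section \<open>Tensors and the Ricci identity\<close>

context levi_civita begin

section \<open>Tensors as multilinear functions of lists of vector fields\<close>

definition fields :: "nat \<Rightarrow> 'a vector_field list set" where
  "fields r = {Xs. length Xs = r \<and> set Xs \<subseteq> VF}"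

lemma fields_length: "Xs \<in> fields r \<Longrightarrow> length Xs = r"
  by (simp add: fields_def)

lemma fields_nth: "Xs \<in> fields r \<Longrightarrow> i < r \<Longrightarrow> Xs ! i \<in> VF"
  by (auto simp: fields_def)

lemma fields_update: "Xs \<in> fields r \<Longrightarrow> X \<in> VF \<Longrightarrow> Xs[i := X] \<in> fields r"
  using set_update_subsetI[of Xs VF X i] by (simp add: fields_def)

lemma fields_snoc: "Xs \<in> fields r \<Longrightarrow> V \<in> VF \<Longrightarrow> Xs @ [V] \<in> fields (Suc r)"
  by (auto simp: fields_def)

lemma fields_SucE:
  assumes "Zs \<in> fields (Suc r)"
  obtains Xs V where "Zs = Xs @ [V]" "Xs \<in> fields r" "V \<in> VF"
  using assms by (cases Zs rule: rev_cases) (auto simp: fields_def)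

text \<open>Tensoriality is linearity over the smooth functions on \<open>U\<close>. The equations
  are required only at points of \<open>U\<close>, because \<open>D X Y\<close> is unconstrained
  elsewhere.\<close>

definition tensor_on :: "nat \<Rightarrow> 'a tensor \<Rightarrow> bool" where
  "tensor_on r T \<longleftrightarrow> (\<forall>Xs\<in>fields r. smooth (T Xs) \<and> (\<forall>i<r. \<forall>q\<in>U.
     (\<forall>X\<in>VF. \<forall>Y\<in>VF. T (Xs[i := (\<lambda>q f. X q f + Y q f)]) q = T (Xs[i := X]) q + T (Xs[i := Y]) q) \<and>
     (\<forall>h. \<forall>X\<in>VF. smooth h \<longrightarrow> T (Xs[i := (\<lambda>q f. h q * X q f)]) q = h q * T (Xs[i := X]) q)))"

lemma tensor_smooth: "tensor_on r T \<Longrightarrow> Xs \<in> fields r \<Longrightarrow> smooth (T Xs)"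
  by (simp add: tensor_on_def)

lemma tensor_add:
  "tensor_on r T \<Longrightarrow> Xs \<in> fields r \<Longrightarrow> i < r \<Longrightarrow> q \<in> U \<Longrightarrow> X \<in> VF \<Longrightarrow> Y \<in> VF \<Longrightarrow>
    T (Xs[i := (\<lambda>q f. X q f + Y q f)]) q = T (Xs[i := X]) q + T (Xs[i := Y]) q"
  by (simp add: tensor_on_def)

lemma tensor_scale:
  "tensor_on r T \<Longrightarrow> Xs \<in> fields r \<Longrightarrow> i < r \<Longrightarrow> q \<in> U \<Longrightarrow> X \<in> VF \<Longrightarrow> smooth h \<Longrightarrow>
    T (Xs[i := (\<lambda>q f. h q * X q f)]) q = h q * T (Xs[i := X]) q"
  by (simp add: tensor_on_def)

lemma tensor_onI:
  assumes "\<And>Xs. Xs \<in> fields r \<Longrightarrow> smooth (T Xs)"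
    and "\<And>Xs i q X Y. Xs \<in> fields r \<Longrightarrow> i < r \<Longrightarrow> q \<in> U \<Longrightarrow> X \<in> VF \<Longrightarrow> Y \<in> VF \<Longrightarrow>
      T (Xs[i := (\<lambda>q f. X q f + Y q f)]) q = T (Xs[i := X]) q + T (Xs[i := Y]) q"
    and "\<And>Xs i q X h. Xs \<in> fields r \<Longrightarrow> i < r \<Longrightarrow> q \<in> U \<Longrightarrow> X \<in> VF \<Longrightarrow> smooth h \<Longrightarrow>
      T (Xs[i := (\<lambda>q f. h q * X q f)]) q = h q * T (Xs[i := X]) q"
  shows "tensor_on r T"
  using assms unfolding tensor_on_def by simp

text \<open>Scaling the slot by the indicator function of \<open>U\<close> keeps the value at
  \<open>q\<close> and makes the two arguments equal as functions. The rules for \<open>D\<close>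
  hold only on \<open>U\<close>, so they enter tensor arguments this way.\<close>

lemma tensor_cong:
  assumes T: "tensor_on r T" "Xs \<in> fields r" "i < r" "q \<in> U" and X: "X \<in> VF" "Y \<in> VF"
    and eq: "\<And>r. r \<in> U \<Longrightarrow> X r = Y r"
  shows "T (Xs[i := X]) q = T (Xs[i := Y]) q"
proof -
  let ?h = "indicator U :: 'a \<Rightarrow> real"
  have "(\<lambda>r f. ?h r * X r f) = (\<lambda>r f. ?h r * Y r f)"
    using eq by (auto simp: indicator_def fun_eq_iff)
  then show ?thesis
    using tensor_scale[OF T X(1) smooth_indicator[OF openU]]
      tensor_scale[OF T X(2) smooth_indicator[OF openU]] T(4) by simp
qed

lemma tensor_uminus:
  "tensor_on r T \<Longrightarrow> Xs \<in> fields r \<Longrightarrow> i < r \<Longrightarrow> q \<in> U \<Longrightarrow> X \<in> VF \<Longrightarrow>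
    T (Xs[i := (\<lambda>q f. - X q f)]) q = - T (Xs[i := X]) q"
  using tensor_scale[OF _ _ _ _ _ smooth_const[OF openU, of "-1"], of r T Xs i q X] by simp

lemma tensor_diff:
  "tensor_on r T \<Longrightarrow> Xs \<in> fields r \<Longrightarrow> i < r \<Longrightarrow> q \<in> U \<Longrightarrow> X \<in> VF \<Longrightarrow> Y \<in> VF \<Longrightarrow>
    T (Xs[i := (\<lambda>q f. X q f - Y q f)]) q = T (Xs[i := X]) q - T (Xs[i := Y]) q"
  using tensor_add[of r T Xs i q X "\<lambda>q f. - Y q f"] tensor_uminus[of r T Xs i q Y] VF_uminus[of Y]
  by simp

lemma tensor_sum:
  assumes T: "tensor_on r T" "Xs \<in> fields r" "i < r" "q \<in> U" and X: "\<And>k. k \<in> K \<Longrightarrow> X k \<in> VF"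
  shows "T (Xs[i := (\<lambda>q f. \<Sum>k\<in>K. X k q f)]) q = (\<Sum>k\<in>K. T (Xs[i := X k]) q)"
proof -
  have 0: "T (Xs[i := (\<lambda>q f. 0)]) q = 0"
    using tensor_scale[OF T VF_zero smooth_const[OF openU, of 0]] by simp
  show ?thesis
    using X
  proof (induction K rule: infinite_finite_induct)
    case (insert k K)
    then have "T (Xs[i := (\<lambda>q f. X k q f + (\<Sum>k\<in>K. X k q f))]) q =
        T (Xs[i := X k]) q + T (Xs[i := (\<lambda>q f. \<Sum>k\<in>K. X k q f)]) q"
      by (intro tensor_add[OF T] VF_sum) auto
    then show ?case using insert by simp
  qed (simp_all add: 0)
qed

section \<open>The covariant derivative of a tensor\<close>

lemma cov_deriv_snoc:
  "cov_deriv D T (Xs @ [V]) q = V q (T Xs) - (\<Sum>i<length Xs. T (Xs[i := D V (Xs ! i)]) q)"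
  by (simp add: cov_deriv_def)

text \<open>The correction term of slot \<open>i\<close> is split off, and in the others the update
  of slot \<open>i\<close> is moved to the end, so that linearity in slot \<open>i\<close> can be
  applied to each term.\<close>

lemma cov_deriv_slot:
  assumes "length Xs = r" "i < r"
  shows "cov_deriv D T (Xs[i := Z] @ [V]) q = V q (T (Xs[i := Z])) - T (Xs[i := D V Z]) q
    - (\<Sum>j\<in>{..<r} - {i}. T (Xs[j := D V (Xs ! j), i := Z]) q)"
proof -
  have "(\<Sum>j\<in>{..<r} - {i}. T (Xs[i := Z, j := D V (Xs[i := Z] ! j)]) q) =
      (\<Sum>j\<in>{..<r} - {i}. T (Xs[j := D V (Xs ! j), i := Z]) q)"
    by (rule sum.cong) (auto simp: list_update_swap)
  then show ?thesis
    using assms by (simp add: cov_deriv_snoc sum.remove[of "{..<r}" i])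
qed

text \<open>In a slot of \<open>T\<close>, the derivative of the coefficient \<open>h\<close>
  appears once from differentiating the function and once from \<open>D_scale_right\<close>, and the
  two cancel. The last slot is the direction, where \<open>D\<close> is linear over
  functions.\<close>

lemma tensor_cov_deriv:
  assumes T: "tensor_on r T"
  shows "tensor_on (Suc r) (cov_deriv D T)"
proof (rule tensor_onI)
  fix Zs assume "Zs \<in> fields (Suc r)"
  then obtain Xs V where Z: "Zs = Xs @ [V]" "Xs \<in> fields r" "V \<in> VF" by (rule fields_SucE)
  have "smooth (\<lambda>q. V q (T Xs) - (\<Sum>i<r. T (Xs[i := D V (Xs ! i)]) q))"
    by (intro smooth_diff VF_smooth[OF Z(3)] smooth_sum tensor_smooth[OF T] fields_update Z VF_D openU
      fields_nth[OF Z(2)]) simp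
  then show "smooth (cov_deriv D T Zs)"
    by (rule smooth_cong) (simp add: Z(1) cov_deriv_snoc fields_length[OF Z(2)])
next
  fix Zs i q X Y assume "Zs \<in> fields (Suc r)" and i: "i < Suc r" and q: "q \<in> U"
    and X: "X \<in> VF" and Y: "Y \<in> VF"
  then obtain Xs V where Z: "Zs = Xs @ [V]" "Xs \<in> fields r" "V \<in> VF"
    using fields_SucE by blast
  note len = fields_length[OF Z(2)]
  let ?XY = "\<lambda>q f. X q f + Y q f"
  show "cov_deriv D T (Zs[i := ?XY]) q = cov_deriv D T (Zs[i := X]) q + cov_deriv D T (Zs[i := Y]) q"
  proof (cases "i < r")
    case True
    note F = fields_update[OF Z(2)]
    have "V q (T (Xs[i := ?XY])) = V q (\<lambda>q. T (Xs[i := X]) q + T (Xs[i := Y]) q)"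
      by (rule apply_cong[OF Z(3) q q tensor_smooth[OF T F[OF VF_add[OF X Y]]]])
        (rule tensor_add[OF T Z(2) True _ X Y])
    also have "\<dots> = V q (T (Xs[i := X])) + V q (T (Xs[i := Y]))"
      by (rule apply_add[OF Z(3) q q]) (intro tensor_smooth[OF T] F X Y)+
    finally have 1: "V q (T (Xs[i := ?XY])) = V q (T (Xs[i := X])) + V q (T (Xs[i := Y]))" .
    have "T (Xs[i := D V ?XY]) q = T (Xs[i := (\<lambda>q f. D V X q f + D V Y q f)]) q"
      by (rule tensor_cong[OF T Z(2) True q])
        (auto intro!: VF_D VF_add Z X Y D_add_right)
    also have "\<dots> = T (Xs[i := D V X]) q + T (Xs[i := D V Y]) q"
      by (intro tensor_add[OF T Z(2) True q] VF_D Z X Y)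
    finally have 2: "T (Xs[i := D V ?XY]) q = T (Xs[i := D V X]) q + T (Xs[i := D V Y]) q" .
    have 3: "(\<Sum>j\<in>{..<r} - {i}. T (Xs[j := D V (Xs ! j), i := ?XY]) q) =
        (\<Sum>j\<in>{..<r} - {i}. T (Xs[j := D V (Xs ! j), i := X]) q) +
        (\<Sum>j\<in>{..<r} - {i}. T (Xs[j := D V (Xs ! j), i := Y]) q)"
      unfolding sum.distrib[symmetric]
      by (intro sum.cong refl tensor_add[OF T _ True q X Y] F VF_D Z fields_nth[OF Z(2)]) simp
    show ?thesis
      using True by (simp add: Z(1) list_update_append len cov_deriv_slot[OF len True] 1 2 3)
  next
    case False
    then have "i = r" using i by simp
    have "(\<Sum>j<r. T (Xs[j := D ?XY (Xs ! j)]) q) =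
      (\<Sum>j<r. T (Xs[j := (\<lambda>q f. D X (Xs ! j) q f + D Y (Xs ! j) q f)]) q)"
      by (intro sum.cong refl tensor_cong[OF T Z(2) _ q])
        (auto intro!: VF_D VF_add X Y fields_nth[OF Z(2)] D_add_left)
    also have "\<dots> = (\<Sum>j<r. T (Xs[j := D X (Xs ! j)]) q) + (\<Sum>j<r. T (Xs[j := D Y (Xs ! j)]) q)"
      unfolding sum.distrib[symmetric]
      by (intro sum.cong refl tensor_add[OF T Z(2) _ q])
        (auto intro!: VF_D VF_add X Y fields_nth[OF Z(2)])
    finally show ?thesis
      by (simp add: \<open>i = r\<close> Z(1) len list_update_append cov_deriv_snoc)
  qed
next
  fix Zs i q X h assume "Zs \<in> fields (Suc r)" and i: "i < Suc r" and q: "q \<in> U"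
    and X: "X \<in> VF" and h: "smooth h"
  then obtain Xs V where Z: "Zs = Xs @ [V]" "Xs \<in> fields r" "V \<in> VF"
    using fields_SucE by blast
  note len = fields_length[OF Z(2)]
  let ?hX = "\<lambda>q f. h q * X q f"
  show "cov_deriv D T (Zs[i := ?hX]) q = h q * cov_deriv D T (Zs[i := X]) q"
  proof (cases "i < r")
    case True
    note F = fields_update[OF Z(2)]
    have "V q (T (Xs[i := ?hX])) = V q (\<lambda>q. h q * T (Xs[i := X]) q)"
      by (rule apply_cong[OF Z(3) q q tensor_smooth[OF T F[OF VF_scale[OF h X]]]])
        (rule tensor_scale[OF T Z(2) True _ X h])
    also have "\<dots> = h q * V q (T (Xs[i := X])) + T (Xs[i := X]) q * V q h"
      by (rule apply_mult[OF Z(3) q q]) (intro tensor_smooth[OF T] F X h)+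
    finally have 1: "V q (T (Xs[i := ?hX])) = h q * V q (T (Xs[i := X])) + T (Xs[i := X]) q * V q h" .
    have "T (Xs[i := D V ?hX]) q = T (Xs[i := (\<lambda>q f. V q h * X q f + h q * D V X q f)]) q"
      by (rule tensor_cong[OF T Z(2) True q])
        (auto intro!: VF_D VF_add VF_scale VF_smooth[OF Z(3) h] h Z X D_scale_right)
    also have "\<dots> = T (Xs[i := (\<lambda>q f. V q h * X q f)]) q + T (Xs[i := (\<lambda>q f. h q * D V X q f)]) q"
      by (intro tensor_add[OF T Z(2) True q] VF_D VF_scale VF_smooth[OF Z(3) h] Z X h)
    also have "\<dots> = V q h * T (Xs[i := X]) q + h q * T (Xs[i := D V X]) q"
      using tensor_scale[OF T Z(2) True q X VF_smooth[OF Z(3) h]]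
        tensor_scale[OF T Z(2) True q VF_D[OF Z(3) X] h] by simp
    finally have 2: "T (Xs[i := D V ?hX]) q = V q h * T (Xs[i := X]) q + h q * T (Xs[i := D V X]) q" .
    have 3: "(\<Sum>j\<in>{..<r} - {i}. T (Xs[j := D V (Xs ! j), i := ?hX]) q) =
        h q * (\<Sum>j\<in>{..<r} - {i}. T (Xs[j := D V (Xs ! j), i := X]) q)"
      unfolding sum_distrib_left
      by (intro sum.cong refl tensor_scale[OF T _ True q X h] F VF_D Z fields_nth[OF Z(2)]) simp
    show ?thesis
      using True
      by (simp add: Z(1) list_update_append len cov_deriv_slot[OF len True] 1 2 3 algebra_simps)
  next
    case False
    then have "i = r" using i by simp
    have "(\<Sum>j<r. T (Xs[j := D ?hX (Xs ! j)]) q) =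
      (\<Sum>j<r. T (Xs[j := (\<lambda>q f. h q * D X (Xs ! j) q f)]) q)"
      by (intro sum.cong refl tensor_cong[OF T Z(2) _ q])
        (auto intro!: VF_D VF_scale h X fields_nth[OF Z(2)] D_scale_left)
    also have "\<dots> = h q * (\<Sum>j<r. T (Xs[j := D X (Xs ! j)]) q)"
      unfolding sum_distrib_left
      by (intro sum.cong refl tensor_scale[OF T Z(2) _ q])
        (auto intro!: VF_D VF_add X h fields_nth[OF Z(2)])
    finally show ?thesis
      by (simp add: \<open>i = r\<close> Z(1) len list_update_append cov_deriv_snoc algebra_simps)
  qed
qed

text \<open>\<open>V\<close> sees only the values near \<open>q\<close>, and the corrected argument
  lists again consist of fields on \<open>U\<close>. It is used to differentiate a tensor known to
  vanish on \<open>U\<close>.\<close>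

lemma cov_deriv_cong:
  assumes "Xs \<in> fields r" "V \<in> VF" "q \<in> U" "\<And>Ys. Ys \<in> fields r \<Longrightarrow> smooth (T Ys)"
    and eq: "\<And>Ys s. Ys \<in> fields r \<Longrightarrow> s \<in> U \<Longrightarrow> T Ys s = T' Ys s"
  shows "cov_deriv D T (Xs @ [V]) q = cov_deriv D T' (Xs @ [V]) q"
proof -
  have "V q (T Xs) = V q (T' Xs)"
    by (rule apply_cong[OF assms(2,3,3)]) (use assms in auto)
  moreover have "T (Xs[i := D V (Xs ! i)]) q = T' (Xs[i := D V (Xs ! i)]) q" if "i < length Xs" for i
    using that assms(3) fields_length[OF assms(1)]
    by (intro eq fields_update assms VF_D fields_nth[OF assms(1)]) auto
  ultimately show ?thesis by (simp add: cov_deriv_snoc)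
qed

section \<open>The Ricci identity for tensors of any rank\<close>

lemma VF_curv: "X \<in> VF \<Longrightarrow> Y \<in> VF \<Longrightarrow> Z \<in> VF \<Longrightarrow> curv X Y Z \<in> VF"
  unfolding curvature_operator_def by (intro VF_diff VF_D VF_bracket)

text \<open>In \<open>Xs @ [Y, Z]\<close> the direction \<open>Z\<close> is the later one, hence the
  order \<open>curv Z Y\<close>. Derivatives acting on the value of \<open>T\<close> cancel because
  the connection is torsion-free; those that act twice on the same slot assemble to the
  curvature.\<close>

lemma ricci_identity:
  assumes T: "tensor_on r T" and Xs: "Xs \<in> fields r" and Y: "Y \<in> VF" and Z: "Z \<in> VF" and q: "q \<in> U"
  shows "cov_deriv D (cov_deriv D T) (Xs @ [Y, Z]) q - cov_deriv D (cov_deriv D T) (Xs @ [Z, Y]) q =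
    - (\<Sum>i<r. T (Xs[i := curv Z Y (Xs ! i)]) q)"
proof -
  note len = fields_length[OF Xs] and F = fields_update[OF Xs] and nth = fields_nth[OF Xs]
  \<comment> \<open>These are the mixed terms, in which two different slots are differentiated. They
    are symmetric in \<open>Y\<close> and \<open>Z\<close> and so drop out of the
    commutator.\<close>
  define off where "off Y Z = (\<Sum>i<r. \<Sum>j\<in>{..<r} - {i}. T (Xs[j := D Y (Xs ! j), i := D Z (Xs ! i)]) q)"
    for Y Z
  have exp: "cov_deriv D (cov_deriv D T) (Xs @ [Y, Z]) q =
      Z q (\<lambda>r. Y r (T Xs))
      - (\<Sum>i<r. Z q (T (Xs[i := D Y (Xs ! i)]))) - (\<Sum>i<r. Y q (T (Xs[i := D Z (Xs ! i)])))
      + (\<Sum>i<r. T (Xs[i := D Y (D Z (Xs ! i))]) q) + off Y Z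
      - D Z Y q (T Xs) + (\<Sum>i<r. T (Xs[i := D (D Z Y) (Xs ! i)]) q)"
    if Y: "Y \<in> VF" and Z: "Z \<in> VF" for Y Z
  proof -
    have "Z q (cov_deriv D T (Xs @ [Y])) =
        Z q (\<lambda>s. Y s (T Xs) - (\<Sum>i<r. T (Xs[i := D Y (Xs ! i)]) s))"
      by (rule apply_cong[OF Z q q tensor_smooth[OF tensor_cov_deriv[OF T] fields_snoc[OF Xs Y]]])
        (simp add: cov_deriv_snoc len)
    also have "\<dots> = Z q (\<lambda>s. Y s (T Xs)) - Z q (\<lambda>s. \<Sum>i<r. T (Xs[i := D Y (Xs ! i)]) s)"
      by (rule apply_diff[OF Z q q])
        (rule VF_smooth[OF Y tensor_smooth[OF T Xs]],
          intro smooth_sum openU Y tensor_smooth[OF T] F VF_D nth, simp)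
    also have "Z q (\<lambda>s. \<Sum>i<r. T (Xs[i := D Y (Xs ! i)]) s) = (\<Sum>i<r. Z q (T (Xs[i := D Y (Xs ! i)])))"
      by (rule apply_sum[OF Z q]) (intro tensor_smooth[OF T] F VF_D Y nth, simp)
    finally have 1: "Z q (cov_deriv D T (Xs @ [Y])) =
        Z q (\<lambda>r. Y r (T Xs)) - (\<Sum>i<r. Z q (T (Xs[i := D Y (Xs ! i)])))" .
    have 2: "(\<Sum>i<r. cov_deriv D T (Xs[i := D Z (Xs ! i)] @ [Y]) q) =
        (\<Sum>i<r. Y q (T (Xs[i := D Z (Xs ! i)]))) - (\<Sum>i<r. T (Xs[i := D Y (D Z (Xs ! i))]) q) - off Y Z"
      unfolding off_def sum_subtractf[symmetric]
      by (intro sum.cong refl) (simp add: cov_deriv_slot[OF len])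
    have "cov_deriv D (cov_deriv D T) (Xs @ [Y, Z]) q =
        cov_deriv D (cov_deriv D T) ((Xs @ [Y]) @ [Z]) q" by simp
    also have "\<dots> = Z q (cov_deriv D T (Xs @ [Y]))
        - ((\<Sum>i<r. cov_deriv D T (Xs[i := D Z (Xs ! i)] @ [Y]) q) + cov_deriv D T (Xs @ [D Z Y]) q)"
      unfolding cov_deriv_snoc[of "cov_deriv D T"]
      by (simp add: len nth_append list_update_append lessThan_Suc add.commute)
    finally show ?thesis
      unfolding 1 2 by (simp add: cov_deriv_snoc len algebra_simps)
  qed
  have off: "off Y Z = off Z Y"
  proof -
    have "off Y Z = (\<Sum>i<r. \<Sum>j | j < r \<and> i \<noteq> j. T (Xs[j := D Y (Xs ! j), i := D Z (Xs ! i)]) q)"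
      unfolding off_def by (intro sum.cong refl) auto
    also have "\<dots> = (\<Sum>j<r. \<Sum>i | i < r \<and> i \<noteq> j. T (Xs[j := D Y (Xs ! j), i := D Z (Xs ! i)]) q)"
      using sum.swap_restrict[of "{..<r}" "{..<r}" "\<lambda>i j. T (Xs[j := D Y (Xs ! j), i := D Z (Xs ! i)]) q"
          "\<lambda>i j. i \<noteq> j"] by simp
    also have "\<dots> = off Z Y"
      unfolding off_def by (intro sum.cong) (auto simp: list_update_swap)
    finally show ?thesis .
  qed
  \<comment> \<open>Torsion-freeness: the commutator of the second derivatives of the function
    \<open>T Xs\<close> is absorbed by the corrections of the direction slot.\<close>
  have br: "Z q (\<lambda>s. Y s (T Xs)) - Y q (\<lambda>s. Z s (T Xs)) = D Z Y q (T Xs) - D Y Z q (T Xs)"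
    using bracket_eq[OF Z Y q] bracket_apply[OF tensor_smooth[OF T Xs] q, of Z Y] by metis
  have R: "(\<Sum>i<r. T (Xs[i := curv Z Y (Xs ! i)]) q) =
      (\<Sum>i<r. T (Xs[i := D Z (D Y (Xs ! i))]) q) - (\<Sum>i<r. T (Xs[i := D Y (D Z (Xs ! i))]) q)
      - ((\<Sum>i<r. T (Xs[i := D (D Z Y) (Xs ! i)]) q) - (\<Sum>i<r. T (Xs[i := D (D Y Z) (Xs ! i)]) q))"
    unfolding sum_subtractf[symmetric]
  proof (intro sum.cong refl)
    fix i assume "i \<in> {..<r}"
    then have i: "i < r" by simp
    note X = nth[OF i] and tm = tensor_diff[OF T Xs i q]
    have "T (Xs[i := D (bracket Z Y) (Xs ! i)]) q =
        T (Xs[i := (\<lambda>q f. D (D Z Y) (Xs ! i) q f - D (D Y Z) (Xs ! i) q f)]) q"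
    proof (rule tensor_cong[OF T Xs i q])
      fix s assume s: "s \<in> U"
      have "D (bracket Z Y) (Xs ! i) s = D (\<lambda>q f. D Z Y q f - D Y Z q f) (Xs ! i) s"
        by (rule D_cong) (auto simp: bracket_eq Y Z X VF_bracket VF_D VF_diff s)
      then show "D (bracket Z Y) (Xs ! i) s = (\<lambda>f. D (D Z Y) (Xs ! i) s f - D (D Y Z) (Xs ! i) s f)"
        using D_diff_left[OF VF_D[OF Z Y] VF_D[OF Y Z] X s] by simp
    qed (intro VF_D VF_diff VF_bracket X Y Z)+
    then show "T (Xs[i := curv Z Y (Xs ! i)]) q =
        T (Xs[i := D Z (D Y (Xs ! i))]) q - T (Xs[i := D Y (D Z (Xs ! i))]) q
        - (T (Xs[i := D (D Z Y) (Xs ! i)]) q - T (Xs[i := D (D Y Z) (Xs ! i)]) q)"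
      unfolding curvature_operator_def
      by (simp add: tm VF_diff VF_D VF_bracket X Y Z)
  qed
  show ?thesis
    unfolding exp[OF Y Z] exp[OF Z Y] R off using br by simp
qed

end

section \<open>Symmetries of the curvature tensor\<close>

context levi_civita begin

section \<open>Tensoriality of the curvature operator and the two Bianchi identities\<close>

lemma D_bracket_left:
  assumes "X \<in> VF" "Y \<in> VF" "Z \<in> VF" "q \<in> U"
  shows "D (bracket X Y) Z q = (\<lambda>f. D (D X Y) Z q f - D (D Y X) Z q f)"
proof -
  have "D (bracket X Y) Z q = D (\<lambda>q f. D X Y q f - D Y X q f) Z q"
    by (rule D_cong) (auto simp: bracket_eq VF_bracket VF_D VF_diff assms)
  then show ?thesis
    by (simp add: D_diff_left VF_D assms)
qed

lemma D_bracket_right: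
  assumes "X \<in> VF" "Y \<in> VF" "Z \<in> VF" "q \<in> U"
  shows "D Z (bracket X Y) q = (\<lambda>f. D Z (D X Y) q f - D Z (D Y X) q f)"
proof -
  have "D Z (bracket X Y) q = D Z (\<lambda>q f. D X Y q f - D Y X q f) q"
    by (rule D_cong) (auto simp: bracket_eq VF_bracket VF_D VF_diff assms)
  then show ?thesis
    by (simp add: D_diff_right VF_D assms)
qed

text \<open>Torsion-freeness eliminates the bracket, so only iterated covariant derivatives
  remain.\<close>

lemma curv_eq:
  assumes "X \<in> VF" "Y \<in> VF" "Z \<in> VF" "q \<in> U"
  shows "curv X Y Z q f =
    D X (D Y Z) q f - D Y (D X Z) q f - D (D X Y) Z q f + D (D Y X) Z q f"
  by (simp add: curvature_operator_def D_bracket_left assms)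

text \<open>An inner derivative can be rewritten only through an equation valid on all of
  \<open>U\<close>, combined with the locality of the outer one.\<close>

lemma D_D_right:
  assumes "\<And>s. s \<in> U \<Longrightarrow> D Y Z s = E s" "X \<in> VF" "Y \<in> VF" "Z \<in> VF" "q \<in> U"
  shows "D X (D Y Z) q = D X E q"
  using assms by (intro D_cong VF_cong[OF VF_D, of Y Z E] VF_D) auto

lemma D_D_left:
  assumes "\<And>s. s \<in> U \<Longrightarrow> D X Y s = E s" "X \<in> VF" "Y \<in> VF" "Z \<in> VF" "q \<in> U"
  shows "D (D X Y) Z q = D E Z q"
  using assms by (intro D_cong VF_cong[OF VF_D, of X Y E] VF_D) auto

lemma curv_antisym:
  assumes "X \<in> VF" "Y \<in> VF" "Z \<in> VF" "q \<in> U"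
  shows "curv X Y Z q = (\<lambda>f. - curv Y X Z q f)"
  by (simp add: curv_eq assms fun_eq_iff)

lemma curv_add_1:
  assumes X: "X \<in> VF" "X' \<in> VF" "Y \<in> VF" "Z \<in> VF" and q: "q \<in> U"
  shows "curv (\<lambda>q f. X q f + X' q f) Y Z q = (\<lambda>f. curv X Y Z q f + curv X' Y Z q f)"
proof
  fix f
  let ?S = "\<lambda>q f. X q f + X' q f"
  have S: "?S \<in> VF" using X by (simp add: VF_add)
  have "D Y (D ?S Z) q = D Y (\<lambda>q f. D X Z q f + D X' Z q f) q"
    by (rule D_D_right) (auto simp: D_add_left X S q)
  moreover have "D (D ?S Y) Z q = D (\<lambda>q f. D X Y q f + D X' Y q f) Z q"
    by (rule D_D_left) (auto simp: D_add_left X S q)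
  moreover have "D (D Y ?S) Z q = D (\<lambda>q f. D Y X q f + D Y X' q f) Z q"
    by (rule D_D_left) (auto simp: D_add_right X S q)
  ultimately show "curv ?S Y Z q f = curv X Y Z q f + curv X' Y Z q f"
    by (simp add: curv_eq X S q VF_D D_add_left D_add_right)
qed

text \<open>The derivative of \<open>h\<close> along \<open>Y\<close> arises from
  \<open>D Y (D X Z)\<close> and from \<open>D (D Y X) Z\<close> with opposite signs.\<close>

lemma curv_scale_1:
  assumes X: "X \<in> VF" "Y \<in> VF" "Z \<in> VF" and h: "smooth h" and q: "q \<in> U"
  shows "curv (\<lambda>q f. h q * X q f) Y Z q = (\<lambda>f. h q * curv X Y Z q f)"
proof
  fix f
  let ?S = "\<lambda>q f. h q * X q f"
  have S: "?S \<in> VF" using X h by (simp add: VF_scale)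
  note Yh = VF_smooth[OF X(2) h]
  have "D Y (D ?S Z) q = D Y (\<lambda>q f. h q * D X Z q f) q"
    by (rule D_D_right) (auto simp: D_scale_left X S q h)
  moreover have "D (D ?S Y) Z q = D (\<lambda>q f. h q * D X Y q f) Z q"
    by (rule D_D_left) (auto simp: D_scale_left X S q h)
  moreover have "D (D Y ?S) Z q = D (\<lambda>q f. Y q h * X q f + h q * D Y X q f) Z q"
    by (rule D_D_left) (auto simp: D_scale_right X S q h)
  moreover have "\<dots> = (\<lambda>f. Y q h * D X Z q f + h q * D (D Y X) Z q f)"
    using D_add_left[OF VF_scale[OF Yh X(1)] VF_scale[OF h VF_D[OF X(2,1)]] X(3) q]
      D_scale_left[OF Yh X(1) X(3) q] D_scale_left[OF h VF_D[OF X(2,1)] X(3) q] by simp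
  ultimately show "curv ?S Y Z q f = h q * curv X Y Z q f"
    by (simp add: curv_eq X S q h VF_D D_scale_left D_scale_right algebra_simps)
qed

lemma curv_add_2:
  assumes X: "X \<in> VF" "X' \<in> VF" "Y \<in> VF" "Z \<in> VF" and q: "q \<in> U"
  shows "curv Y (\<lambda>q f. X q f + X' q f) Z q = (\<lambda>f. curv Y X Z q f + curv Y X' Z q f)"
  using curv_add_1[OF X q] curv_antisym[OF X(3) VF_add[OF X(1,2)] X(4) q]
    curv_antisym[OF X(3,1,4) q] curv_antisym[OF X(3,2,4) q] by (simp add: fun_eq_iff)

lemma curv_scale_2:
  assumes X: "X \<in> VF" "Y \<in> VF" "Z \<in> VF" and h: "smooth h" and q: "q \<in> U"
  shows "curv Y (\<lambda>q f. h q * X q f) Z q = (\<lambda>f. h q * curv Y X Z q f)"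
  using curv_scale_1[OF X h q] curv_antisym[OF X(2) VF_scale[OF h X(1)] X(3) q]
    curv_antisym[OF X(2,1,3) q] by (simp add: fun_eq_iff)

lemma curv_add_3:
  assumes X: "X \<in> VF" "Y \<in> VF" "Z \<in> VF" "Z' \<in> VF" and q: "q \<in> U"
  shows "curv X Y (\<lambda>q f. Z q f + Z' q f) q = (\<lambda>f. curv X Y Z q f + curv X Y Z' q f)"
proof
  fix f
  let ?S = "\<lambda>q f. Z q f + Z' q f"
  have S: "?S \<in> VF" using X by (simp add: VF_add)
  have "D V (D W ?S) q = D V (\<lambda>q f. D W Z q f + D W Z' q f) q" if "V \<in> VF" "W \<in> VF" for V W
    by (rule D_D_right) (auto simp: D_add_right X S q that)
  then show "curv X Y ?S q f = curv X Y Z q f + curv X Y Z' q f"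
    by (simp add: curv_eq X S q VF_D D_add_right)
qed

text \<open>First derivatives of \<open>h\<close> multiply terms symmetric in \<open>X\<close> and
  \<open>Y\<close>, which cancel. The second derivatives leave the bracket of \<open>X\<close> and
  \<open>Y\<close> applied to \<open>h\<close>, which the bracket term of the curvature
  removes.\<close>

lemma curv_scale_3:
  assumes X: "X \<in> VF" "Y \<in> VF" "Z \<in> VF" and h: "smooth h" and q: "q \<in> U"
  shows "curv X Y (\<lambda>q f. h q * Z q f) q = (\<lambda>f. h q * curv X Y Z q f)"
proof
  fix f
  let ?S = "\<lambda>q f. h q * Z q f"
  have S: "?S \<in> VF" using X h by (simp add: VF_scale)
  have DD: "D V (D W ?S) q f = V q (\<lambda>q. W q h) * Z q f + W q h * D V Z q f
      + (V q h * D W Z q f + h q * D V (D W Z) q f)" if VW: "V \<in> VF" "W \<in> VF" for V W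
  proof -
    note Wh = VF_smooth[OF VW(2) h]
    have "D V (D W ?S) q = D V (\<lambda>q f. W q h * Z q f + h q * D W Z q f) q"
      by (rule D_D_right) (auto simp: D_scale_right X S q VW h)
    then show ?thesis
      using D_add_right[OF VW(1) VF_scale[OF Wh X(3)] VF_scale[OF h VF_D[OF VW(2) X(3)]] q]
        D_scale_right[OF Wh VW(1) X(3) q] D_scale_right[OF h VW(1) VF_D[OF VW(2) X(3)] q] by simp
  qed
  have br: "X q (\<lambda>q. Y q h) - Y q (\<lambda>q. X q h) = D X Y q h - D Y X q h"
    using bracket_eq[OF X(1,2) q] bracket_apply[OF h q, of X Y] by metis
  have "X q (\<lambda>q. Y q h) * Z q f - Y q (\<lambda>q. X q h) * Z q f
      - (D X Y q h * Z q f - D Y X q h * Z q f) = 0"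
    unfolding left_diff_distrib[symmetric] br by simp
  then show "curv X Y ?S q f = h q * curv X Y Z q f"
    by (simp add: curv_eq X S q h VF_D D_scale_right DD algebra_simps)
qed

text \<open>This is the Jacobi identity with every bracket written through the torsion-free
  connection.\<close>

lemma curv_bianchi:
  assumes X: "X \<in> VF" "Y \<in> VF" "Z \<in> VF" and q: "q \<in> U"
  shows "curv X Y Z q f + curv Y Z X q f + curv Z X Y q f = 0"
proof -
  have br: "bracket X (bracket Y Z) q f = D X (D Y Z) q f - D X (D Z Y) q f
      - (D (D Y Z) X q f - D (D Z Y) X q f)" if "X \<in> VF" "Y \<in> VF" "Z \<in> VF" for X Y Z
    using that q by (simp add: bracket_eq[of X "bracket Y Z"] VF_bracket D_bracket_left D_bracket_right)
  show ?thesis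
    using jacobi[OF X q, of f] by (simp add: br curv_eq X q)
qed

text \<open>The covariant derivative along \<open>S\<close> of the vector-valued curvature tensor,
  evaluated at \<open>X\<close>, \<open>Y\<close>, \<open>Z\<close>. It has its own definition
  because \<open>cov_deriv\<close> acts on real-valued tensors.\<close>

definition dcurv :: "'a vector_field \<Rightarrow> 'a vector_field \<Rightarrow> 'a vector_field \<Rightarrow> 'a vector_field \<Rightarrow> 'a vector_field" where
  "dcurv S X Y Z = (\<lambda>q f. D S (curv X Y Z) q f - curv (D S X) Y Z q f - curv X (D S Y) Z q f
     - curv X Y (D S Z) q f)"

lemma VF_dcurv: "S \<in> VF \<Longrightarrow> X \<in> VF \<Longrightarrow> Y \<in> VF \<Longrightarrow> Z \<in> VF \<Longrightarrow> dcurv S X Y Z \<in> VF"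
  unfolding dcurv_def by (intro VF_diff VF_D VF_curv)

lemma dcurv_bianchi:
  assumes X: "S \<in> VF" "X \<in> VF" "Y \<in> VF" "Z \<in> VF" and q: "q \<in> U"
  shows "dcurv S X Y Z q f + dcurv X Y S Z q f + dcurv Y S X Z q f = 0"
proof -
  let ?E = "\<lambda>X Y Z q f. D X (D Y Z) q f - D Y (D X Z) q f - D (D X Y) Z q f + D (D Y X) Z q f"
  have E: "?E X Y Z \<in> VF" if "X \<in> VF" "Y \<in> VF" "Z \<in> VF" for X Y Z
    using that by (intro VF_add VF_diff VF_D)
  have R: "D S (curv X Y Z) q f = D S (D X (D Y Z)) q f - D S (D Y (D X Z)) q f
      - D S (D (D X Y) Z) q f + D S (D (D Y X) Z) q f"
    if V: "S \<in> VF" "X \<in> VF" "Y \<in> VF" "Z \<in> VF" for S X Y Z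
  proof -
    have "D S (curv X Y Z) q = D S (?E X Y Z) q"
      by (rule D_cong) (auto simp: V q curv_eq fun_eq_iff VF_curv E)
    then show ?thesis by (simp add: D_add_right D_diff_right VF_diff VF_D V q)
  qed
  have L: "D (curv X Y S) Z q f = D (D X (D Y S)) Z q f - D (D Y (D X S)) Z q f
      - D (D (D X Y) S) Z q f + D (D (D Y X) S) Z q f"
    if V: "S \<in> VF" "X \<in> VF" "Y \<in> VF" "Z \<in> VF" for S X Y Z
  proof -
    have "D (curv X Y S) Z q = D (?E X Y S) Z q"
      by (rule D_cong) (auto simp: V q curv_eq fun_eq_iff VF_curv E)
    then show ?thesis by (simp add: D_add_left D_diff_left VF_diff VF_D V q)
  qed
  \<comment> \<open>Third derivatives cancel in the cyclic sum except for derivatives of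
    \<open>Z\<close> along second derivatives of the other fields. These are accounted for by
    \<open>D ?C Z\<close>, which is zero by the first Bianchi identity.\<close>
  let ?C = "\<lambda>q f. curv S X Y q f + curv X Y S q f + curv Y S X q f"
  have "D ?C Z q f = D (curv S X Y) Z q f + D (curv X Y S) Z q f + D (curv Y S X) Z q f"
    by (simp add: D_add_left VF_add VF_curv X q)
  moreover have "D ?C Z q = D (\<lambda>q f. 0 * Z q f) Z q"
    by (rule D_cong) (auto simp: X q VF_add VF_curv VF_zero curv_bianchi)
  moreover have "D (\<lambda>q f. 0 * Z q f) Z q f = 0"
    using D_scale_left[OF smooth_const[OF openU, of 0] X(4) X(4) q] by simp
  ultimately show ?thesis
    unfolding dcurv_def by (simp add: R L curv_eq X q VF_D)
qed

lemma metric_add3_right: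
  "X \<in> VF \<Longrightarrow> Y \<in> VF \<Longrightarrow> W \<in> VF \<Longrightarrow> Z \<in> VF \<Longrightarrow> q \<in> U \<Longrightarrow>
    g q (Z q) (\<lambda>f. X q f + Y q f + W q f) = g q (Z q) (X q) + g q (Z q) (Y q) + g q (Z q) (W q)"
  using metric_add_right[of "\<lambda>q f. X q f + Y q f" W Z q] metric_add_right[of X Y Z q] VF_add[of X Y]
  by simp

lemma metric_diff4_right:
  "X \<in> VF \<Longrightarrow> Y \<in> VF \<Longrightarrow> W \<in> VF \<Longrightarrow> V \<in> VF \<Longrightarrow> Z \<in> VF \<Longrightarrow> q \<in> U \<Longrightarrow>
    g q (Z q) (\<lambda>f. X q f - Y q f - W q f - V q f) =
      g q (Z q) (X q) - g q (Z q) (Y q) - g q (Z q) (W q) - g q (Z q) (V q)"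
  using metric_diff_right[of "\<lambda>q f. X q f - Y q f - W q f" V Z q]
    metric_diff_right[of "\<lambda>q f. X q f - Y q f" W Z q]
    metric_diff_right[of X Y Z q] VF_diff[of X Y] VF_diff[of "\<lambda>q f. X q f - Y q f" W]
  by simp

section \<open>Algebraic symmetries of the Riemann tensor\<close>

abbreviation "Rm \<equiv> riemann M A g D"

lemma metric_scale_right:
  "X \<in> VF \<Longrightarrow> Z \<in> VF \<Longrightarrow> q \<in> U \<Longrightarrow> g q (Z q) (\<lambda>f. c * X q f) = c * g q (Z q) (X q)"
  using metric_scale_left[of X Z q c] metric_sym[OF VF_scale[OF smooth_const[OF openU, of c]], of X Z q]
    metric_sym[of X Z q] by simp

lemma metric_zero_right: "Z \<in> VF \<Longrightarrow> q \<in> U \<Longrightarrow> g q (Z q) (\<lambda>f. 0) = 0"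
  using metric_scale_right[of Z Z q 0] by simp

lemma metric_uminus_right:
  "X \<in> VF \<Longrightarrow> Z \<in> VF \<Longrightarrow> q \<in> U \<Longrightarrow> g q (Z q) (\<lambda>f. - X q f) = - g q (Z q) (X q)"
  using metric_scale_right[of X Z q "-1"] by simp

lemma fields_4E:
  assumes "Xs \<in> fields 4"
  obtains X Y Z V where "Xs = [X, Y, Z, V]" "X \<in> VF" "Y \<in> VF" "Z \<in> VF" "V \<in> VF"
  using assms by (auto simp: fields_def numeral_eq_Suc length_Suc_conv)

lemma tensor_Rm: "tensor_on 4 (tensor4 Rm)"
proof (rule tensor_onI)
  fix Xs assume "Xs \<in> fields 4"
  then show "smooth (tensor4 Rm Xs)"
    by (elim fields_4E) (auto simp: tensor4_def riemann_def intro!: metric_smooth VF_curv)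
next
  fix Xs and i :: nat and q X Y
  assume "Xs \<in> fields 4" and i: "i < 4" and q: "q \<in> U" and X: "X \<in> VF" and Y: "Y \<in> VF"
  then obtain a b c d where Xs: "Xs = [a, b, c, d]" "a \<in> VF" "b \<in> VF" "c \<in> VF" "d \<in> VF"
    by (elim fields_4E)
  from i consider "i = 0" | "i = 1" | "i = 2" | "i = 3" by linarith
  then show "tensor4 Rm (Xs[i := (\<lambda>q f. X q f + Y q f)]) q =
      tensor4 Rm (Xs[i := X]) q + tensor4 Rm (Xs[i := Y]) q"
    by cases (simp_all add: numeral_eq_Suc tensor4_def riemann_def Xs X Y q metric_add_left
      metric_add_right curv_add_1 curv_add_2 curv_add_3 VF_curv)
next
  fix Xs and i :: nat and q X h
  assume "Xs \<in> fields 4" and i: "i < 4" and q: "q \<in> U" and X: "X \<in> VF" and h: "smooth h"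
  then obtain a b c d where Xs: "Xs = [a, b, c, d]" "a \<in> VF" "b \<in> VF" "c \<in> VF" "d \<in> VF"
    by (elim fields_4E)
  from i consider "i = 0" | "i = 1" | "i = 2" | "i = 3" by linarith
  then show "tensor4 Rm (Xs[i := (\<lambda>q f. h q * X q f)]) q = h q * tensor4 Rm (Xs[i := X]) q"
    by cases (simp_all add: numeral_eq_Suc tensor4_def riemann_def Xs X h q metric_scale_left
      metric_scale_right curv_scale_1 curv_scale_2 curv_scale_3 VF_curv)
qed

lemma Rm_antisym_34:
  "X \<in> VF \<Longrightarrow> Y \<in> VF \<Longrightarrow> Z \<in> VF \<Longrightarrow> V \<in> VF \<Longrightarrow> q \<in> U \<Longrightarrow> Rm X Y V Z q = - Rm X Y Z V q"
  unfolding riemann_def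
  by (simp add: curv_antisym[of V Z] metric_uminus_right VF_curv)

lemma Rm_bianchi:
  assumes X: "X \<in> VF" "Y \<in> VF" "Z \<in> VF" "V \<in> VF" and q: "q \<in> U"
  shows "Rm X Y Z V q + Rm X Z V Y q + Rm X V Y Z q = 0"
proof -
  have "Rm X Y Z V q + Rm X Z V Y q + Rm X V Y Z q =
      g q (X q) (\<lambda>f. curv Z V Y q f + curv V Y Z q f + curv Y Z V q f)"
    unfolding riemann_def by (simp add: metric_add3_right VF_curv X q)
  also have "\<dots> = g q (X q) (\<lambda>f. 0)"
    by (simp add: curv_bianchi X q)
  finally show ?thesis
    by (simp add: metric_zero_right X q)
qed

abbreviation metric_tensor :: "'a tensor" where
  "metric_tensor \<equiv> (\<lambda>Xs q. g q ((Xs ! 0) q) ((Xs ! 1) q))"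

lemma fields_2E:
  assumes "Xs \<in> fields 2"
  obtains X Y where "Xs = [X, Y]" "X \<in> VF" "Y \<in> VF"
  using assms by (auto simp: fields_def numeral_eq_Suc length_Suc_conv)

lemma tensor_metric: "tensor_on 2 metric_tensor"
proof (rule tensor_onI)
  fix Xs assume "Xs \<in> fields 2"
  then show "smooth (metric_tensor Xs)"
    by (elim fields_2E) (simp add: metric_smooth)
next
  fix Xs and i :: nat and q X Y
  assume "Xs \<in> fields 2" and i: "i < 2" and q: "q \<in> U" and X: "X \<in> VF" and Y: "Y \<in> VF"
  then obtain a b where Xs: "Xs = [a, b]" "a \<in> VF" "b \<in> VF"
    by (elim fields_2E)
  from i consider "i = 0" | "i = 1" by linarith
  then show "metric_tensor (Xs[i := (\<lambda>q f. X q f + Y q f)]) q =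
      metric_tensor (Xs[i := X]) q + metric_tensor (Xs[i := Y]) q"
    by cases (simp_all add: Xs X Y q metric_add_left metric_add_right)
next
  fix Xs and i :: nat and q X h
  assume "Xs \<in> fields 2" and i: "i < 2" and q: "q \<in> U" and X: "X \<in> VF" and h: "smooth h"
  then obtain a b where Xs: "Xs = [a, b]" "a \<in> VF" "b \<in> VF"
    by (elim fields_2E)
  from i consider "i = 0" | "i = 1" by linarith
  then show "metric_tensor (Xs[i := (\<lambda>q f. h q * X q f)]) q = h q * metric_tensor (Xs[i := X]) q"
    by cases (simp_all add: Xs X h q metric_scale_left metric_scale_right)
qed

lemma metric_parallel:
  "X \<in> VF \<Longrightarrow> Y \<in> VF \<Longrightarrow> V \<in> VF \<Longrightarrow> q \<in> U \<Longrightarrow> cov_deriv D metric_tensor [X, Y, V] q = 0"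
  using metric_compat[of V X Y q] by (simp add: cov_deriv_def lessThan_Suc numeral_eq_Suc)

text \<open>The Ricci identity for the metric tensor: metric compatibility makes its second
  derivatives vanish, and the curvature terms of the two slots must then add up to zero.\<close>

lemma Rm_antisym_12:
  assumes X: "X \<in> VF" "Y \<in> VF" "Z \<in> VF" "V \<in> VF" and q: "q \<in> U"
  shows "Rm Y X Z V q = - Rm X Y Z V q"
proof -
  have F: "[X, Y] \<in> fields 2" by (simp add: fields_def X)
  have "cov_deriv D (cov_deriv D metric_tensor) ([X, Y] @ [Z, V]) q = 0"
    if "Z \<in> VF" "V \<in> VF" for Z V
  proof -
    have "cov_deriv D (cov_deriv D metric_tensor) (([X, Y] @ [Z]) @ [V]) q =
        cov_deriv D (\<lambda>_ _. 0) (([X, Y] @ [Z]) @ [V]) q"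
    proof (rule cov_deriv_cong[OF fields_snoc[OF F that(1)] that(2) q])
      fix Ys assume Ys: "Ys \<in> fields (Suc 2)"
      then show "smooth (cov_deriv D metric_tensor Ys)"
        by (rule tensor_smooth[OF tensor_cov_deriv[OF tensor_metric]])
      fix s assume "s \<in> U"
      moreover from Ys obtain Zs V where "Ys = Zs @ [V]" "Zs \<in> fields 2" "V \<in> VF" by (rule fields_SucE)
      moreover from this(2) obtain X Y where "Zs = [X, Y]" "X \<in> VF" "Y \<in> VF" by (rule fields_2E)
      ultimately show "cov_deriv D metric_tensor Ys s = 0"
        using metric_parallel[of X Y V s] by simp
    qed
    also have "\<dots> = 0"
      by (simp only: cov_deriv_snoc tangent_const[OF VF_tangent[OF that(2) q] q openU]) simp
    finally show ?thesis by simp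
  qed
  then have "(\<Sum>i<2. metric_tensor ([X, Y][i := curv Z V ([X, Y] ! i)]) q) = 0"
    using ricci_identity[OF tensor_metric F X(4,3) q] X by simp
  then show ?thesis
    using metric_sym[OF VF_curv[OF X(3,4,1)] X(2) q] by (simp add: riemann_def numeral_eq_Suc)
qed

text \<open>The classical octahedron argument: four first Bianchi identities, with each argument in
  turn held first, combine linearly with the two antisymmetries.\<close>

lemma Rm_pair_sym:
  assumes X: "X \<in> VF" "Y \<in> VF" "Z \<in> VF" "V \<in> VF" and q: "q \<in> U"
  shows "Rm Z V X Y q = Rm X Y Z V q"
  using Rm_bianchi[OF X(1,2,3,4) q] Rm_bianchi[OF X(2,3,4,1) q] Rm_bianchi[OF X(3,4,1,2) q]
    Rm_bianchi[OF X(4,1,2,3) q]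
    Rm_antisym_12[OF X(1,2,3,4) q] Rm_antisym_12[OF X(1,3,4,2) q] Rm_antisym_12[OF X(1,4,2,3) q]
    Rm_antisym_12[OF X(2,3,4,1) q] Rm_antisym_12[OF X(2,4,1,3) q] Rm_antisym_12[OF X(3,4,1,2) q]
    Rm_antisym_34[OF X(1,2,3,4) q] Rm_antisym_34[OF X(1,3,2,4) q] Rm_antisym_34[OF X(1,4,2,3) q]
    Rm_antisym_34[OF X(2,3,1,4) q] Rm_antisym_34[OF X(2,4,1,3) q] Rm_antisym_34[OF X(3,4,1,2) q]
    Rm_antisym_34[OF X(2,1,3,4) q] Rm_antisym_34[OF X(3,1,2,4) q] Rm_antisym_34[OF X(4,1,2,3) q]
    Rm_antisym_34[OF X(3,2,1,4) q] Rm_antisym_34[OF X(4,2,1,3) q] Rm_antisym_34[OF X(4,3,1,2) q]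
  by linarith

section \<open>Symmetries of the derivative of the Riemann tensor\<close>

abbreviation "DRm \<equiv> cov_deriv D (tensor4 Rm)"

lemma DRm_expand:
  "DRm [X, Y, Z, V, S] q = S q (Rm X Y Z V) - Rm (D S X) Y Z V q - Rm X (D S Y) Z V q
    - Rm X Y (D S Z) V q - Rm X Y Z (D S V) q"
  by (simp add: cov_deriv_def tensor4_def lessThan_Suc numeral_eq_Suc)

text \<open>Metric compatibility carries the derivative past \<open>g\<close>, and the part falling
  on \<open>X\<close> cancels its correction term. This transfers the second Bianchi identity from
  operators to tensors.\<close>

lemma DRm_dcurv:
  assumes X: "X \<in> VF" "Y \<in> VF" "Z \<in> VF" "V \<in> VF" "S \<in> VF" and q: "q \<in> U"
  shows "DRm [X, Y, Z, V, S] q = g q (X q) (dcurv S Z V Y q)"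
  unfolding DRm_expand riemann_def dcurv_def
  using metric_compat[OF X(5,1) VF_curv[OF X(3,4,2)] q]
  by (simp add: metric_diff4_right VF_D VF_curv X q)

lemma DRm_bianchi:
  assumes X: "X \<in> VF" "Y \<in> VF" "Z \<in> VF" "V \<in> VF" "S \<in> VF" and q: "q \<in> U"
  shows "DRm [X, Y, Z, V, S] q + DRm [X, Y, V, S, Z] q + DRm [X, Y, S, Z, V] q = 0"
proof -
  have "DRm [X, Y, Z, V, S] q + DRm [X, Y, V, S, Z] q + DRm [X, Y, S, Z, V] q =
      g q (X q) (\<lambda>f. dcurv S Z V Y q f + dcurv Z V S Y q f + dcurv V S Z Y q f)"
    by (simp add: DRm_dcurv metric_add3_right VF_dcurv X q)
  also have "\<dots> = g q (X q) (\<lambda>f. 0)"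
    by (simp add: dcurv_bianchi X q)
  finally show ?thesis
    by (simp add: metric_zero_right X q)
qed

lemma smooth_Rm: "X \<in> VF \<Longrightarrow> Y \<in> VF \<Longrightarrow> Z \<in> VF \<Longrightarrow> V \<in> VF \<Longrightarrow> smooth (Rm X Y Z V)"
  unfolding riemann_def by (intro metric_smooth VF_curv)

text \<open>The symmetry of \<open>Rm\<close> holds throughout \<open>U\<close> and for all fields,
  so it passes to the differentiated function and to each correction term alike.\<close>

lemma DRm_antisym_12:
  assumes X: "X \<in> VF" "Y \<in> VF" "Z \<in> VF" "V \<in> VF" "S \<in> VF" and q: "q \<in> U"
  shows "DRm [Y, X, Z, V, S] q = - DRm [X, Y, Z, V, S] q"
proof -
  have "S q (Rm Y X Z V) = S q (\<lambda>q. - Rm X Y Z V q)"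
    by (rule apply_cong[OF X(5) q q smooth_Rm]) (simp_all add: X Rm_antisym_12[of X Y Z V])
  also have "\<dots> = - S q (Rm X Y Z V)"
    by (rule apply_uminus[OF X(5) q q]) (simp add: smooth_Rm X)
  finally show ?thesis
    by (simp add: DRm_expand Rm_antisym_12[of X Y] Rm_antisym_12[of X "D S Y"]
      Rm_antisym_12[of "D S X" Y] X q VF_D)
qed

lemma DRm_pair_sym:
  assumes X: "X \<in> VF" "Y \<in> VF" "Z \<in> VF" "V \<in> VF" "S \<in> VF" and q: "q \<in> U"
  shows "DRm [Z, V, X, Y, S] q = DRm [X, Y, Z, V, S] q"
proof -
  have "S q (Rm Z V X Y) = S q (Rm X Y Z V)"
    by (rule apply_cong[OF X(5) q q smooth_Rm]) (simp_all add: X Rm_pair_sym)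
  then show ?thesis
    by (simp add: DRm_expand X q VF_D Rm_pair_sym[of X Y Z V] Rm_pair_sym[of "D S X" Y Z V]
       Rm_pair_sym[of X "D S Y" Z V] Rm_pair_sym[of X Y "D S Z" V] Rm_pair_sym[of X Y Z "D S V"])
qed

lemma DRm_antisym_34:
  assumes X: "X \<in> VF" "Y \<in> VF" "Z \<in> VF" "V \<in> VF" "S \<in> VF" and q: "q \<in> U"
  shows "DRm [X, Y, V, Z, S] q = - DRm [X, Y, Z, V, S] q"
  using DRm_pair_sym[OF X q] DRm_pair_sym[OF X(1,2,4,3,5) q] DRm_antisym_12[OF X(3,4,1,2,5) q]
  by simp

end

section \<open>Orthonormal frames and the Bochner formula\<close>

context levi_civita begin

section \<open>The Ricci identity differentiated once more\<close>

text \<open>The derivative along \<open>V\<close> of \<open>ricci_identity\<close>. On the right the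
  product rule separates the derivative of \<open>T\<close> from that of the curvature, the latter
  being \<open>dcurv\<close>. It handles the commutation of the first two derivative indices under a
  third derivative.\<close>

lemma ricci_identity_deriv:
  assumes T: "tensor_on r T" and Xs: "Xs \<in> fields r"
    and Y: "Y \<in> VF" and Z: "Z \<in> VF" and V: "V \<in> VF" and q: "q \<in> U"
  shows "cov_deriv D (cov_deriv D (cov_deriv D T)) (Xs @ [Y, Z, V]) q
      - cov_deriv D (cov_deriv D (cov_deriv D T)) (Xs @ [Z, Y, V]) q =
    - (\<Sum>i<r. cov_deriv D T (Xs[i := curv Z Y (Xs ! i)] @ [V]) q + T (Xs[i := dcurv V Z Y (Xs ! i)]) q)"
proof -
  note len = fields_length[OF Xs] and F = fields_update[OF Xs] and nth = fields_nth[OF Xs]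
  let ?P = "cov_deriv D (cov_deriv D T)"
  note P = tensor_cov_deriv[OF tensor_cov_deriv[OF T]]
  have FP: "Xs @ [Y, Z] \<in> fields (Suc (Suc r))" if "Y \<in> VF" "Z \<in> VF" for Y Z
    using fields_snoc[OF fields_snoc[OF Xs that(1)] that(2)] by simp
  have exp: "cov_deriv D ?P (Xs @ [Y, Z, V]) q = V q (?P (Xs @ [Y, Z]))
      - (\<Sum>i<r. ?P (Xs[i := D V (Xs ! i)] @ [Y, Z]) q) - ?P (Xs @ [D V Y, Z]) q - ?P (Xs @ [Y, D V Z]) q"
    for Y Z
    using cov_deriv_snoc[of ?P "Xs @ [Y, Z]" V q]
    by (simp add: len nth_append list_update_append lessThan_Suc add.commute)
  have "V q (?P (Xs @ [Y, Z])) - V q (?P (Xs @ [Z, Y])) =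
      V q (\<lambda>s. ?P (Xs @ [Y, Z]) s - ?P (Xs @ [Z, Y]) s)"
    by (rule apply_diff[OF V q q tensor_smooth[OF P] tensor_smooth[OF P], symmetric])
      (simp_all add: FP Y Z)
  also have "\<dots> = V q (\<lambda>s. - (\<Sum>i<r. T (Xs[i := curv Z Y (Xs ! i)]) s))"
    by (rule apply_cong[OF V q q smooth_diff[OF tensor_smooth[OF P] tensor_smooth[OF P]]])
      (simp_all add: FP Y Z ricci_identity[OF T Xs])
  also have "\<dots> = - V q (\<lambda>s. \<Sum>i<r. T (Xs[i := curv Z Y (Xs ! i)]) s)"
    by (rule apply_uminus[OF V q q]) (intro smooth_sum openU tensor_smooth[OF T] F VF_curv Y Z nth, simp)
  also have "V q (\<lambda>s. \<Sum>i<r. T (Xs[i := curv Z Y (Xs ! i)]) s) =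
      (\<Sum>i<r. V q (T (Xs[i := curv Z Y (Xs ! i)])))"
    by (rule apply_sum[OF V q]) (intro tensor_smooth[OF T] F VF_curv Y Z nth, simp)
  also have "\<dots> = (\<Sum>i<r. cov_deriv D T (Xs[i := curv Z Y (Xs ! i)] @ [V]) q
      + T (Xs[i := D V (curv Z Y (Xs ! i))]) q
      + (\<Sum>j\<in>{..<r} - {i}. T (Xs[j := D V (Xs ! j), i := curv Z Y (Xs ! i)]) q))"
    by (intro sum.cong refl) (simp add: cov_deriv_slot[OF len])
  finally have 1: "V q (?P (Xs @ [Y, Z])) - V q (?P (Xs @ [Z, Y])) =
      - (\<Sum>i<r. cov_deriv D T (Xs[i := curv Z Y (Xs ! i)] @ [V]) q)
      - (\<Sum>i<r. T (Xs[i := D V (curv Z Y (Xs ! i))]) q)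
      - (\<Sum>i<r. \<Sum>j\<in>{..<r} - {i}. T (Xs[j := D V (Xs ! j), i := curv Z Y (Xs ! i)]) q)"
    by (simp add: sum.distrib)
  have "(\<Sum>i<r. ?P (Xs[i := D V (Xs ! i)] @ [Y, Z]) q) - (\<Sum>i<r. ?P (Xs[i := D V (Xs ! i)] @ [Z, Y]) q) =
      - (\<Sum>i<r. \<Sum>j<r. T (Xs[i := D V (Xs ! i), j := curv Z Y (Xs[i := D V (Xs ! i)] ! j)]) q)"
    unfolding sum_subtractf[symmetric] sum_negf[symmetric]
    by (intro sum.cong refl, subst ricci_identity[OF T F[OF VF_D[OF V nth]] Y Z q])
      (simp_all add: sum_negf)
  also have "\<dots> = - (\<Sum>i<r. T (Xs[i := curv Z Y (D V (Xs ! i))]) q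
      + (\<Sum>j\<in>{..<r} - {i}. T (Xs[i := D V (Xs ! i), j := curv Z Y (Xs ! j)]) q))"
    by (intro arg_cong[of _ _ uminus] sum.cong refl)
      (simp add: sum.remove[of "{..<r}" for r] len cong: sum.cong_simp)
  also have "\<dots> = - (\<Sum>i<r. T (Xs[i := curv Z Y (D V (Xs ! i))]) q)
      - (\<Sum>i<r. \<Sum>j\<in>{..<r} - {i}. T (Xs[i := D V (Xs ! i), j := curv Z Y (Xs ! j)]) q)"
    by (simp add: sum.distrib)
  also have "(\<Sum>i<r. \<Sum>j\<in>{..<r} - {i}. T (Xs[i := D V (Xs ! i), j := curv Z Y (Xs ! j)]) q) =
      (\<Sum>i<r. \<Sum>j\<in>{..<r} - {i}. T (Xs[j := D V (Xs ! j), i := curv Z Y (Xs ! i)]) q)"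
  proof -
    \<comment> \<open>The inequality is written in both orientations, one for each order of
      summation in the exchange that identifies the mixed terms.\<close>
    have *: "{..<r} - {i} = {j. j \<in> {..<r} \<and> i \<noteq> j}" "{..<r} - {i} = {j. j \<in> {..<r} \<and> j \<noteq> i}" for i
      by auto
    show ?thesis
      by (subst *(1), subst *(2), subst sum.swap_restrict) auto
  qed
  finally have 2: "(\<Sum>i<r. ?P (Xs[i := D V (Xs ! i)] @ [Y, Z]) q) - (\<Sum>i<r. ?P (Xs[i := D V (Xs ! i)] @ [Z, Y]) q) =
      - (\<Sum>i<r. T (Xs[i := curv Z Y (D V (Xs ! i))]) q)
      - (\<Sum>i<r. \<Sum>j\<in>{..<r} - {i}. T (Xs[j := D V (Xs ! j), i := curv Z Y (Xs ! i)]) q)" .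
  have 3: "?P (Xs @ [D V Y, Z]) q - ?P (Xs @ [Z, D V Y]) q =
      - (\<Sum>i<r. T (Xs[i := curv Z (D V Y) (Xs ! i)]) q)"
    "?P (Xs @ [Y, D V Z]) q - ?P (Xs @ [D V Z, Y]) q = - (\<Sum>i<r. T (Xs[i := curv (D V Z) Y (Xs ! i)]) q)"
    by (intro ricci_identity[OF T Xs] VF_D Y Z V q)+
  \<comment> \<open>The derivative of the curvature vector and the corrections for \<open>Z\<close>,
    \<open>Y\<close> and the slot entry, which came up separately above, are the four terms of
    \<open>dcurv\<close>.\<close>
  have 4: "(\<Sum>i<r. T (Xs[i := dcurv V Z Y (Xs ! i)]) q) =
      (\<Sum>i<r. T (Xs[i := D V (curv Z Y (Xs ! i))]) q) - (\<Sum>i<r. T (Xs[i := curv (D V Z) Y (Xs ! i)]) q)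
      - (\<Sum>i<r. T (Xs[i := curv Z (D V Y) (Xs ! i)]) q) - (\<Sum>i<r. T (Xs[i := curv Z Y (D V (Xs ! i))]) q)"
    unfolding sum_subtractf[symmetric]
  proof (intro sum.cong refl)
    fix i assume "i \<in> {..<r}"
    then have i: "i < r" by simp
    show "T (Xs[i := dcurv V Z Y (Xs ! i)]) q =
        T (Xs[i := D V (curv Z Y (Xs ! i))]) q - T (Xs[i := curv (D V Z) Y (Xs ! i)]) q
        - T (Xs[i := curv Z (D V Y) (Xs ! i)]) q - T (Xs[i := curv Z Y (D V (Xs ! i))]) q"
      unfolding dcurv_def
      by (simp add: tensor_diff[OF T Xs i q] VF_diff VF_D VF_curv nth[OF i] Y Z V)
  qed
  show ?thesis
    unfolding exp sum.distrib using 1 2 3 4 by linarith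
qed

lemma tensor_append:
  assumes T: "tensor_on (Suc r) T" and Y: "Y \<in> VF"
  shows "tensor_on r (\<lambda>Xs. T (Xs @ [Y]))"
proof (rule tensor_onI)
  fix Xs assume "Xs \<in> fields r"
  then show "smooth (T (Xs @ [Y]))" by (intro tensor_smooth[OF T] fields_snoc Y)
next
  fix Xs i q X Z assume Xs: "Xs \<in> fields r" "i < r" "q \<in> U" "X \<in> VF" "Z \<in> VF"
  then show "T (Xs[i := (\<lambda>q f. X q f + Z q f)] @ [Y]) q = T (Xs[i := X] @ [Y]) q + T (Xs[i := Z] @ [Y]) q"
    using tensor_add[OF T fields_snoc[OF Xs(1) Y] _ Xs(3-5), of i] fields_length[OF Xs(1)]
    by (simp add: list_update_append)
next
  fix Xs i q X h assume Xs: "Xs \<in> fields r" "i < r" "q \<in> U" "X \<in> VF" "smooth h"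
  then show "T (Xs[i := (\<lambda>q f. h q * X q f)] @ [Y]) q = h q * T (Xs[i := X] @ [Y]) q"
    using tensor_scale[OF T fields_snoc[OF Xs(1) Y] _ Xs(3-5), of i] fields_length[OF Xs(1)]
    by (simp add: list_update_append)
qed

text \<open>A frozen last argument receives no correction term, so the missing \<open>D V Y\<close>
  term is added back on the right.\<close>

lemma cov_deriv_append:
  "cov_deriv D (\<lambda>Xs. T (Xs @ [Y])) (Xs @ [V]) q = cov_deriv D T (Xs @ [Y, V]) q + T (Xs @ [D V Y]) q"
  using cov_deriv_snoc[of T "Xs @ [Y]" V q]
  by (simp add: cov_deriv_snoc nth_append list_update_append lessThan_Suc)

end

section \<open>Orthonormal frame components and contractions\<close>

locale levi_civita_frame = levi_civita M A g D U
  for M :: "'a topology" and A :: "('a, 'n::finite) atlas" and g D U +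
  fixes e :: "'n \<Rightarrow> 'a vector_field"
  assumes frame: "orthonormal_frame M A g U e"
begin

lemma VF_frame: "e i \<in> VF"
  using frame by (simp add: orthonormal_frame_def)

lemma frame_metric: "q \<in> U \<Longrightarrow> g q (e i q) (e j q) = (if i = j then 1 else 0)"
  using frame by (simp add: orthonormal_frame_def)

lemma frame_expand:
  assumes X: "X \<in> VF" and q: "q \<in> U"
  shows "X q = (\<lambda>f. \<Sum>k\<in>UNIV. g q (e k q) (X q) * e k q f)"
proof -
  obtain c where c: "X q = (\<lambda>f. \<Sum>i\<in>UNIV. c i * e i q f)"
    using frame VF_tangent[OF X q] q unfolding orthonormal_frame_def by blast
  \<comment> \<open>The coefficients \<open>c\<close> belong to the single point \<open>q\<close>.
    Keeping them constant extends \<open>X q\<close> to a field, to which the linearity of the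
    metric tensor applies.\<close>
  define Y where "Y = (\<lambda>q f. \<Sum>i\<in>UNIV. c i * e i q f)"
  note ce = VF_scale[OF smooth_const[OF openU] VF_frame]
  have "g q (e k q) (X q) = c k" for k
  proof -
    have F: "[e k, e k] \<in> fields 2" by (simp add: fields_def VF_frame)
    have "g q (e k q) (X q) = metric_tensor ([e k, e k][1 := Y]) q"
      by (simp add: c Y_def)
    also have "\<dots> = (\<Sum>i\<in>UNIV. metric_tensor ([e k, e k][1 := (\<lambda>q f. c i * e i q f)]) q)"
      unfolding Y_def by (rule tensor_sum[OF tensor_metric F _ q ce]) simp
    also have "\<dots> = (\<Sum>i\<in>UNIV. c i * metric_tensor ([e k, e k][1 := e i]) q)"
      by (intro sum.cong refl tensor_scale[OF tensor_metric F _ q VF_frame smooth_const[OF openU]]) simp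
    also have "\<dots> = c k"
      by (simp add: frame_metric q if_distrib cong: if_cong)
    finally show ?thesis .
  qed
  then show ?thesis using c by simp
qed

lemma tensor_frame:
  assumes T: "tensor_on r T" "Xs \<in> fields r" "i < r" "q \<in> U" and X: "X \<in> VF"
  shows "T (Xs[i := X]) q = (\<Sum>k\<in>UNIV. g q (e k q) (X q) * T (Xs[i := e k]) q)"
proof -
  note sm = metric_smooth[OF VF_frame X]
  have "T (Xs[i := X]) q = T (Xs[i := (\<lambda>q f. \<Sum>k\<in>UNIV. g q (e k q) (X q) * e k q f)]) q"
    by (rule tensor_cong[OF T X VF_sum[OF VF_scale[OF sm VF_frame]] frame_expand[OF X]])
  also have "\<dots> = (\<Sum>k\<in>UNIV. T (Xs[i := (\<lambda>q f. g q (e k q) (X q) * e k q f)]) q)"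
    by (rule tensor_sum[OF T VF_scale[OF sm VF_frame]])
  also have "\<dots> = (\<Sum>k\<in>UNIV. g q (e k q) (X q) * T (Xs[i := e k]) q)"
    by (intro sum.cong refl tensor_scale[OF T VF_frame sm])
  finally show ?thesis .
qed

lemma tensor_frame_snoc:
  assumes T: "tensor_on (Suc r) T" and Xs: "Xs \<in> fields r" and q: "q \<in> U" and X: "X \<in> VF"
  shows "T (Xs @ [X]) q = (\<Sum>k\<in>UNIV. g q (e k q) (X q) * T (Xs @ [e k]) q)"
  using tensor_frame[OF T fields_snoc[OF Xs X] lessI q X] fields_length[OF Xs]
  by (simp add: list_update_append)

abbreviation conn :: "'a vector_field \<Rightarrow> 'a \<Rightarrow> 'n \<Rightarrow> 'n \<Rightarrow> real" where
  "conn V q j k \<equiv> g q (e k q) (D V (e j) q)"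

text \<open>The products \<open>g (e j) (e k)\<close> are constant, so their derivative, which
  metric compatibility expresses through the connection coefficients, is zero.\<close>

lemma conn_antisym:
  assumes V: "V \<in> VF" and q: "q \<in> U"
  shows "conn V q k j = - conn V q j k"
proof -
  have "V q (\<lambda>s. g s (e j s) (e k s)) = V q (\<lambda>s. if j = k then 1 else 0)"
    by (rule apply_cong[OF V q q metric_smooth]) (simp_all add: VF_frame frame_metric)
  also have "\<dots> = 0" by (rule tangent_const[OF VF_tangent[OF V q] q openU])
  finally show ?thesis
    using metric_compat[OF V VF_frame VF_frame q, of j k] metric_sym[OF VF_D[OF V VF_frame] VF_frame q, of j k]
    by simp
qed

text \<open>Multi-indices, so that full contractions can be written for every rank at once.\<close>

definition idx :: "nat \<Rightarrow> 'n list set" where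
  "idx r = {I. length I = r}"

lemma fields_idx: "I \<in> idx r \<Longrightarrow> map e I \<in> fields r"
  by (auto simp: idx_def fields_def VF_frame)

lemma idx_length: "I \<in> idx r \<Longrightarrow> length I = r"
  by (simp add: idx_def)

text \<open>Exchanging entry \<open>a\<close> of \<open>I\<close> with \<open>k\<close> is an
  involution on the pairs \<open>(I, k)\<close>; it swaps the lower indices of \<open>conn\<close>,
  and hence changes the sign.\<close>

lemma sum_conn_cancel:
  assumes V: "V \<in> VF" and q: "q \<in> U" and a: "a < r"
  shows "(\<Sum>I\<in>idx r. \<Sum>k\<in>UNIV. conn V q (I ! a) k * (s I * t (I[a := k]))) =
    - (\<Sum>I\<in>idx r. \<Sum>k\<in>UNIV. conn V q (I ! a) k * (s (I[a := k]) * t I))"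
proof -
  have "(\<Sum>I\<in>idx r. \<Sum>k\<in>UNIV. conn V q (I ! a) k * (s I * t (I[a := k]))) =
      (\<Sum>(I, k)\<in>idx r \<times> UNIV. conn V q (I ! a) k * (s I * t (I[a := k])))"
    by (simp add: sum.cartesian_product)
  also have "\<dots> = (\<Sum>(I, k)\<in>idx r \<times> UNIV. conn V q k (I ! a) * (s (I[a := k]) * t I))"
    by (rule sum.reindex_bij_witness[of _ "\<lambda>(I, k). (I[a := k], I ! a)" "\<lambda>(I, k). (I[a := k], I ! a)"])
      (use a in \<open>auto simp: idx_def\<close>)
  also have "\<dots> = (\<Sum>I\<in>idx r. \<Sum>k\<in>UNIV. conn V q k (I ! a) * (s (I[a := k]) * t I))"
    by (simp add: sum.cartesian_product)
  also have "\<dots> = (\<Sum>I\<in>idx r. \<Sum>k\<in>UNIV. - (conn V q (I ! a) k * (s (I[a := k]) * t I)))"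
    by (intro sum.cong refl) (subst conn_antisym[OF V q], simp)
  finally show ?thesis by (simp add: sum_negf)
qed

text \<open>The Leibniz rule for a full contraction. The frame need not be parallel, but the
  connection terms from the two factors cancel by \<open>sum_conn_cancel\<close>.\<close>

lemma apply_pairing:
  assumes S: "tensor_on r S" and T: "tensor_on r T" and V: "V \<in> VF" and q: "q \<in> U"
  shows "V q (\<lambda>s. \<Sum>I\<in>idx r. S (map e I) s * T (map e I) s) =
    (\<Sum>I\<in>idx r. cov_deriv D S (map e I @ [V]) q * T (map e I) q
      + S (map e I) q * cov_deriv D T (map e I @ [V]) q)"
proof -
  have ap: "V q (T (map e I)) = cov_deriv D T (map e I @ [V]) q
      + (\<Sum>a<r. \<Sum>k\<in>UNIV. conn V q (I ! a) k * T (map e (I[a := k])) q)"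
    if T: "tensor_on r T" and I: "I \<in> idx r" for T I
  proof -
    have "T ((map e I)[a := D V (e (I ! a))]) q =
        (\<Sum>k\<in>UNIV. conn V q (I ! a) k * T (map e (I[a := k])) q)" if "a < r" for a
      using tensor_frame[OF T fields_idx[OF I] that q VF_D[OF V VF_frame]] by (simp add: map_update)
    then show ?thesis
      by (simp add: cov_deriv_snoc idx_length[OF I])
  qed
  have "V q (\<lambda>s. \<Sum>I\<in>idx r. S (map e I) s * T (map e I) s) =
      (\<Sum>I\<in>idx r. V q (\<lambda>s. S (map e I) s * T (map e I) s))"
    by (rule apply_sum[OF V q]) (intro smooth_mult tensor_smooth[OF S] tensor_smooth[OF T] fields_idx)
  also have "\<dots> = (\<Sum>I\<in>idx r. S (map e I) q * V q (T (map e I)) + T (map e I) q * V q (S (map e I)))"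
    by (intro sum.cong refl apply_mult[OF V q q] tensor_smooth[OF S] tensor_smooth[OF T] fields_idx)
  also have "\<dots> = (\<Sum>I\<in>idx r. cov_deriv D S (map e I @ [V]) q * T (map e I) q
      + S (map e I) q * cov_deriv D T (map e I @ [V]) q)
      + ((\<Sum>I\<in>idx r. \<Sum>a<r. \<Sum>k\<in>UNIV. conn V q (I ! a) k * (S (map e I) q * T (map e (I[a := k])) q))
      + (\<Sum>I\<in>idx r. \<Sum>a<r. \<Sum>k\<in>UNIV. conn V q (I ! a) k * (S (map e (I[a := k])) q * T (map e I) q)))"
    unfolding sum.distrib[symmetric]
    by (intro sum.cong refl)
      (simp add: ap[OF S] ap[OF T] algebra_simps sum.distrib sum_distrib_left)
  also have "(\<Sum>I\<in>idx r. \<Sum>a<r. \<Sum>k\<in>UNIV. conn V q (I ! a) k * (S (map e I) q * T (map e (I[a := k])) q)) =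
      - (\<Sum>I\<in>idx r. \<Sum>a<r. \<Sum>k\<in>UNIV. conn V q (I ! a) k * (S (map e (I[a := k])) q * T (map e I) q))"
    by (subst (1 2) sum.swap, subst sum_negf[symmetric], intro sum.cong refl)
      (simp add: sum_conn_cancel[OF V q, of _ r "\<lambda>I. S (map e I) q" "\<lambda>I. T (map e I) q"])
  finally show ?thesis by simp
qed

text \<open>The contraction rule is applied twice. The second time the direction \<open>Y\<close> is
  frozen so that both factors have rank \<open>r\<close>; the resulting \<open>D Y Y\<close> term is
  exactly the correction in the Hessian of \<open>f\<close>.\<close>

lemma laplacian_normsq:
  fixes T
  assumes T: "tensor_on r T" and q: "q \<in> U"
  defines "f \<equiv> (\<lambda>s. \<Sum>I\<in>idx r. (T (map e I) s)\<^sup>2)"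
  shows "1/2 * laplacian D e (\<lambda>_. f) [] q =
    (\<Sum>m\<in>UNIV. \<Sum>I\<in>idx r. (cov_deriv D T (map e I @ [e m]) q)\<^sup>2
      + T (map e I) q * cov_deriv D (cov_deriv D T) (map e I @ [e m, e m]) q)"
proof -
  note DT = tensor_cov_deriv[OF T]
  have f: "f = (\<lambda>s. \<Sum>I\<in>idx r. T (map e I) s * T (map e I) s)"
    by (simp add: f_def power2_eq_square)
  have Yf: "Y s f = (\<Sum>I\<in>idx r. T (map e I) s * (2 * cov_deriv D T (map e I @ [Y]) s))"
    if "Y \<in> VF" "s \<in> U" for Y s
    unfolding f apply_pairing[OF T T that] by (intro sum.cong refl) simp
  have sf: "smooth f"
    unfolding f by (intro smooth_sum openU smooth_mult tensor_smooth[OF T] fields_idx)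
  have lap: "cov_deriv D (cov_deriv D (\<lambda>_. f)) [Y, Y] q = 2 * (\<Sum>I\<in>idx r.
      (cov_deriv D T (map e I @ [Y]) q)\<^sup>2 + T (map e I) q * cov_deriv D (cov_deriv D T) (map e I @ [Y, Y]) q)"
    if Y: "Y \<in> VF" for Y
  proof -
    note DTY = tensor_append[OF DT Y]
    let ?h = "\<lambda>s. \<Sum>I\<in>idx r. T (map e I) s * cov_deriv D T (map e I @ [Y]) s"
    have sh: "smooth ?h"
      by (intro smooth_sum openU smooth_mult tensor_smooth[OF T] tensor_smooth[OF DTY] fields_idx)
    have "Y q (\<lambda>s. Y s f) = Y q (\<lambda>s. 2 * ?h s)"
      by (rule apply_cong[OF Y q q VF_smooth[OF Y sf]])
        (simp add: Yf[OF Y] sum_distrib_left algebra_simps)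
    also have "\<dots> = 2 * Y q ?h"
      by (rule apply_cmult[OF Y q q sh])
    also have "Y q ?h = (\<Sum>I\<in>idx r. cov_deriv D T (map e I @ [Y]) q * cov_deriv D T (map e I @ [Y]) q
      + T (map e I) q * (cov_deriv D (cov_deriv D T) (map e I @ [Y, Y]) q + cov_deriv D T (map e I @ [D Y Y]) q))"
      using apply_pairing[OF T DTY Y q] by (simp only: cov_deriv_append)
    finally have "Y q (\<lambda>s. Y s f) - D Y Y q f = 2 * (\<Sum>I\<in>idx r. (cov_deriv D T (map e I @ [Y]) q)\<^sup>2
        + T (map e I) q * cov_deriv D (cov_deriv D T) (map e I @ [Y, Y]) q)"
      unfolding Yf[OF VF_D[OF Y Y] q]
      by (simp add: sum_distrib_left sum.distrib algebra_simps power2_eq_square)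
    then show ?thesis by (simp add: cov_deriv_def)
  qed
  show ?thesis
    unfolding laplacian_def append_Nil lap[OF VF_frame] sum_distrib_left[symmetric] by simp
qed

text \<open>Covariant differentiation commutes with the trace, since the corrections of the two
  traced slots cancel by \<open>conn_antisym\<close>.\<close>

lemma contracted_DRm:
  assumes X: "X \<in> VF" "Z \<in> VF" "V \<in> VF" and q: "q \<in> U"
  shows "(\<Sum>t\<in>UNIV. DRm [X, e t, Z, e t, V] q) = V q (ricci M A g D e X Z)
    - ricci M A g D e (D V X) Z q - ricci M A g D e X (D V Z) q"
proof -
  have F: "[X, e t, Z, e k] \<in> fields 4" for t k
    by (simp add: fields_def X VF_frame)
  have 1: "Rm X (D V (e t)) Z (e t) q = (\<Sum>k\<in>UNIV. conn V q t k * Rm X (e k) Z (e t) q)" for t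
    using tensor_frame[OF tensor_Rm F _ q VF_D[OF X(3) VF_frame], of 1 t t] by (simp add: tensor4_def numeral_eq_Suc)
  have 2: "Rm X (e t) Z (D V (e t)) q = (\<Sum>k\<in>UNIV. conn V q t k * Rm X (e t) Z (e k) q)" for t
    using tensor_frame[OF tensor_Rm F _ q VF_D[OF X(3) VF_frame], of 3 t t] by (simp add: tensor4_def numeral_eq_Suc)
  have "(\<Sum>t\<in>UNIV. \<Sum>k\<in>UNIV. conn V q t k * Rm X (e t) Z (e k) q) =
      (\<Sum>t\<in>UNIV. \<Sum>k\<in>UNIV. conn V q k t * Rm X (e k) Z (e t) q)"
    by (rule sum.swap)
  also have "\<dots> = - (\<Sum>t\<in>UNIV. \<Sum>k\<in>UNIV. conn V q t k * Rm X (e k) Z (e t) q)"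
    unfolding sum_negf[symmetric] by (intro sum.cong refl) (subst conn_antisym[OF X(3) q], simp)
  finally have 3: "(\<Sum>t\<in>UNIV. Rm X (e t) Z (D V (e t)) q) = - (\<Sum>t\<in>UNIV. Rm X (D V (e t)) Z (e t) q)"
    by (simp add: 1 2)
  have "V q (ricci M A g D e X Z) = (\<Sum>t\<in>UNIV. V q (Rm X (e t) Z (e t)))"
    unfolding ricci_def by (rule apply_sum[OF X(3) q]) (intro smooth_Rm X VF_frame)
  then show ?thesis
    using 3 by (simp add: DRm_expand sum_subtractf ricci_def)
qed

end

section \<open>Einstein metrics: divergence-free curvature and the commuted Laplacian\<close>

locale einstein_frame = levi_civita_frame M A g D U e
  for M :: "'a topology" and A :: "('a, 'n::finite) atlas" and g D U and e +
  fixes c :: real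
  assumes ricci_frame: "X \<in> VF \<Longrightarrow> Y \<in> VF \<Longrightarrow> q \<in> U \<Longrightarrow> ricci M A g D e X Y q = c * g q (X q) (Y q)"
begin

text \<open>The Ricci tensor is a constant multiple of the parallel metric, so its covariant
  derivative vanishes.\<close>

lemma contracted_DRm_zero:
  assumes X: "X \<in> VF" "Z \<in> VF" "V \<in> VF" and q: "q \<in> U"
  shows "(\<Sum>t\<in>UNIV. DRm [X, e t, Z, e t, V] q) = 0"
proof -
  have "V q (\<lambda>s. c * g s (X s) (Z s)) = V q (ricci M A g D e X Z)"
    by (rule apply_cong[OF X(3) q q smooth_cmult[OF metric_smooth[OF X(1,2)]]])
      (simp add: ricci_frame X)
  then show ?thesis
    using apply_cmult[OF X(3) q q metric_smooth[OF X(1,2)], of c] metric_compat[OF X(3,1,2) q]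
    by (simp add: contracted_DRm X q ricci_frame VF_D algebra_simps)
qed

text \<open>The contracted second Bianchi identity: after pair symmetry the divergence is a
  difference of two covariant derivatives of the Ricci tensor.\<close>

lemma div_Rm:
  assumes X: "X \<in> VF" "Y \<in> VF" "Z \<in> VF" and q: "q \<in> U"
  shows "(\<Sum>t\<in>UNIV. DRm [X, Y, Z, e t, e t] q) = 0"
proof -
  have "DRm [X, Y, Z, e t, e t] q = DRm [Z, e t, X, e t, Y] q - DRm [Z, e t, Y, e t, X] q" for t
    using DRm_bianchi[OF X(3) VF_frame X(1,2) VF_frame q, of t t]
      DRm_pair_sym[OF X(3) VF_frame X(1,2) VF_frame q, of t t]
      DRm_antisym_34[OF X(3) VF_frame X(1) VF_frame X(2) q, of t t] by simp
  then show ?thesis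
    by (simp add: sum_subtractf contracted_DRm_zero X q)
qed

text \<open>\<open>ricci_identity_deriv\<close> for \<open>T\<close> and
  \<open>ricci_identity\<close> for its derivative yield the same curvature sum, hence the factor 2.
  The extra slot of the derivative gives the term with \<open>c\<close>.\<close>

lemma commute_laplacian:
  fixes T
  assumes T: "tensor_on r T" and Xs: "Xs \<in> fields r" and Y: "Y \<in> VF" and q: "q \<in> U"
  shows "(\<Sum>t\<in>UNIV. cov_deriv D (cov_deriv D (cov_deriv D T)) (Xs @ [Y, e t, e t]) q) =
    (\<Sum>t\<in>UNIV. cov_deriv D (cov_deriv D (cov_deriv D T)) (Xs @ [e t, e t, Y]) q)
    + c * cov_deriv D T (Xs @ [Y]) q
    + 2 * (\<Sum>i<r. \<Sum>k\<in>UNIV. \<Sum>t\<in>UNIV. Rm (e k) (Xs ! i) Y (e t) q * cov_deriv D T (Xs[i := e k] @ [e t]) q)"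
    (is "?L = ?R0 + ?R1 + 2 * ?R2")
proof -
  note nth = fields_nth[OF Xs] and DT = tensor_cov_deriv[OF T] and len = fields_length[OF Xs]
  let ?D3 = "cov_deriv D (cov_deriv D (cov_deriv D T))"
  \<comment> \<open>In frame components the derivative of the curvature is traced over its third
    index and the direction; up to sign this is the divergence treated in
    \<open>div_Rm\<close>.\<close>
  have dc: "(\<Sum>t\<in>UNIV. T (Xs[i := dcurv (e t) (e t) Y (Xs ! i)]) q) = 0" if i: "i < r" for i
  proof -
    have "(\<Sum>t\<in>UNIV. T (Xs[i := dcurv (e t) (e t) Y (Xs ! i)]) q) =
        (\<Sum>t\<in>UNIV. \<Sum>k\<in>UNIV. DRm [e k, Xs ! i, e t, Y, e t] q * T (Xs[i := e k]) q)"
      by (intro sum.cong refl)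
        (simp add: tensor_frame[OF T Xs i q VF_dcurv[OF VF_frame VF_frame Y nth[OF i]]]
          DRm_dcurv VF_frame Y nth[OF i] q)
    also have "\<dots> = (\<Sum>k\<in>UNIV. (\<Sum>t\<in>UNIV. DRm [e k, Xs ! i, e t, Y, e t] q) * T (Xs[i := e k]) q)"
      by (subst sum.swap) (simp add: sum_distrib_right)
    also have "\<dots> = (\<Sum>k\<in>UNIV. - (\<Sum>t\<in>UNIV. DRm [e k, Xs ! i, Y, e t, e t] q) * T (Xs[i := e k]) q)"
      unfolding sum_negf[symmetric]
      by (simp add: DRm_antisym_34[OF VF_frame nth[OF i] Y VF_frame VF_frame q])
    also have "\<dots> = 0"
      by (simp add: div_Rm VF_frame nth[OF i] Y q)
    finally show ?thesis .
  qed
  \<comment> \<open>The minus sign comes from reordering \<open>curv (e t) Y\<close> into the index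
    order \<open>Y, e t\<close> of the statement.\<close>
  have cu: "(\<Sum>t\<in>UNIV. \<Sum>i<r. cov_deriv D T (Xs[i := curv (e t) Y (Xs ! i)] @ [e t]) q) = - ?R2"
  proof -
    have "cov_deriv D T (Xs[i := curv (e t) Y (Xs ! i)] @ [e t]) q =
        - (\<Sum>k\<in>UNIV. Rm (e k) (Xs ! i) Y (e t) q * cov_deriv D T (Xs[i := e k] @ [e t]) q)"
      if i: "i < r" for i t
      using tensor_frame[OF DT fields_snoc[OF Xs VF_frame] _ q VF_curv[OF VF_frame Y nth[OF i]], of i t t]
        i len Rm_antisym_34[OF VF_frame nth[OF i] VF_frame Y q, of _ t]
      by (simp add: list_update_append riemann_def sum_negf)
    then have "(\<Sum>t\<in>UNIV. \<Sum>i<r. cov_deriv D T (Xs[i := curv (e t) Y (Xs ! i)] @ [e t]) q) =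
        - (\<Sum>t\<in>UNIV. \<Sum>i<r. \<Sum>k\<in>UNIV. Rm (e k) (Xs ! i) Y (e t) q * cov_deriv D T (Xs[i := e k] @ [e t]) q)"
      by (simp add: sum_negf)
    also have "\<dots> = - ?R2"
      by (subst sum.swap, subst (2) sum.swap) simp
    finally show ?thesis .
  qed
  have ric: "(\<Sum>t\<in>UNIV. cov_deriv D T (Xs @ [curv (e t) Y (e t)]) q) = - ?R1"
  proof -
    have "(\<Sum>t\<in>UNIV. cov_deriv D T (Xs @ [curv (e t) Y (e t)]) q) =
        (\<Sum>t\<in>UNIV. \<Sum>k\<in>UNIV. - Rm (e k) (e t) Y (e t) q * cov_deriv D T (Xs @ [e k]) q)"
      using Rm_antisym_34[OF VF_frame VF_frame VF_frame Y q]
      by (simp add: tensor_frame_snoc[OF DT Xs q VF_curv[OF VF_frame Y VF_frame]] riemann_def)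
    also have "\<dots> = - (\<Sum>k\<in>UNIV. ricci M A g D e (e k) Y q * cov_deriv D T (Xs @ [e k]) q)"
      by (subst sum.swap) (simp add: ricci_def sum_distrib_right sum_negf)
    also have "\<dots> = - (c * cov_deriv D T (Xs @ [Y]) q)"
      by (simp add: ricci_frame VF_frame Y q tensor_frame_snoc[OF DT Xs q Y] sum_distrib_left mult.assoc)
    finally show ?thesis .
  qed
  have "?L - (\<Sum>t\<in>UNIV. ?D3 (Xs @ [e t, Y, e t]) q) =
      - (\<Sum>t\<in>UNIV. \<Sum>i<r. cov_deriv D T (Xs[i := curv (e t) Y (Xs ! i)] @ [e t]) q)
      - (\<Sum>t\<in>UNIV. \<Sum>i<r. T (Xs[i := dcurv (e t) (e t) Y (Xs ! i)]) q)"
    unfolding sum_subtractf[symmetric]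
    by (simp add: ricci_identity_deriv[OF T Xs Y VF_frame VF_frame q] sum_negf sum.distrib
      sum_subtractf)
  moreover have "(\<Sum>t\<in>UNIV. \<Sum>i<r. T (Xs[i := dcurv (e t) (e t) Y (Xs ! i)]) q) = 0"
    by (subst sum.swap) (simp add: dc)
  moreover have "(\<Sum>t\<in>UNIV. ?D3 (Xs @ [e t, Y, e t]) q) - ?R0 =
      - (\<Sum>t\<in>UNIV. \<Sum>i<r. cov_deriv D T (Xs[i := curv (e t) Y (Xs ! i)] @ [e t]) q)
      - (\<Sum>t\<in>UNIV. cov_deriv D T (Xs @ [curv (e t) Y (e t)]) q)"
  proof -
    have "?D3 (Xs @ [e t, Y, e t]) q - ?D3 (Xs @ [e t, e t, Y]) q =
      - (\<Sum>i<r. cov_deriv D T (Xs[i := curv (e t) Y (Xs ! i)] @ [e t]) q)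
      - cov_deriv D T (Xs @ [curv (e t) Y (e t)]) q" for t
      using ricci_identity[OF DT fields_snoc[OF Xs VF_frame] Y VF_frame q, of t t]
      by (simp add: len nth_append list_update_append lessThan_Suc)
    then show ?thesis
      unfolding sum_subtractf[symmetric] by (simp add: sum_negf sum_subtractf)
  qed
  ultimately show ?thesis
    using cu ric by linarith
qed

lemma bochner_deriv:
  fixes T
  assumes T: "tensor_on r T" and q: "q \<in> U"
  shows "1/2 * laplacian D e (\<lambda>_ s. \<Sum>I\<in>idx r. \<Sum>s'\<in>UNIV. (cov_deriv D T (map e I @ [e s']) s)\<^sup>2) [] q =
    (\<Sum>I\<in>idx r. \<Sum>s\<in>UNIV. \<Sum>t\<in>UNIV. (cov_deriv D (cov_deriv D T) (map e I @ [e s, e t]) q)\<^sup>2)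
    + (\<Sum>I\<in>idx r. \<Sum>s\<in>UNIV. cov_deriv D T (map e I @ [e s]) q *
        (\<Sum>t\<in>UNIV. cov_deriv D (cov_deriv D (cov_deriv D T)) (map e I @ [e t, e t, e s]) q))
    + c * (\<Sum>I\<in>idx r. \<Sum>s\<in>UNIV. (cov_deriv D T (map e I @ [e s]) q)\<^sup>2)
    + 2 * (\<Sum>i<r. \<Sum>I\<in>idx r. \<Sum>k\<in>UNIV. \<Sum>s\<in>UNIV. \<Sum>t\<in>UNIV. cov_deriv D T (map e I @ [e s]) q
        * cov_deriv D T (map e (I[i := k]) @ [e t]) q * Rm (e k) (e (I ! i)) (e s) (e t) q)"
proof -
  let ?D1 = "cov_deriv D T" and ?D2 = "cov_deriv D (cov_deriv D T)"
    and ?D3 = "cov_deriv D (cov_deriv D (cov_deriv D T))"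
  \<comment> \<open>A multi-index for the derivative of \<open>T\<close> splits into one for
    \<open>T\<close> and the derivative index \<open>s\<close>.\<close>
  have idx_Suc: "(\<Sum>J\<in>idx (Suc r). F J) = (\<Sum>I\<in>idx r. \<Sum>s\<in>UNIV. F (I @ [s]))" for F :: "'n list \<Rightarrow> real"
  proof -
    have "(\<Sum>J\<in>idx (Suc r). F J) = (\<Sum>(I, s)\<in>idx r \<times> UNIV. F (I @ [s]))"
      by (rule sum.reindex_bij_witness[of _ "\<lambda>(I, s). I @ [s]" "\<lambda>J. (butlast J, last J)"])
        (auto simp: idx_def length_Suc_conv_rev)
    then show ?thesis by (simp add: sum.cartesian_product)
  qed
  have "1/2 * laplacian D e (\<lambda>_ s. \<Sum>I\<in>idx r. \<Sum>s'\<in>UNIV. (?D1 (map e I @ [e s']) s)\<^sup>2) [] q =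
      (\<Sum>t\<in>UNIV. \<Sum>I\<in>idx r. \<Sum>s\<in>UNIV. (?D2 (map e I @ [e s, e t]) q)\<^sup>2
        + ?D1 (map e I @ [e s]) q * ?D3 (map e I @ [e s, e t, e t]) q)"
    using laplacian_normsq[OF tensor_cov_deriv[OF T] q] by (simp add: idx_Suc)
  also have "\<dots> = (\<Sum>I\<in>idx r. \<Sum>s\<in>UNIV. \<Sum>t\<in>UNIV. (?D2 (map e I @ [e s, e t]) q)\<^sup>2
        + ?D1 (map e I @ [e s]) q * ?D3 (map e I @ [e s, e t, e t]) q)"
    by (subst sum.swap, rule sum.cong[OF refl], rule sum.swap)
  also have "\<dots> = (\<Sum>I\<in>idx r. \<Sum>s\<in>UNIV. \<Sum>t\<in>UNIV. (?D2 (map e I @ [e s, e t]) q)\<^sup>2)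
      + (\<Sum>I\<in>idx r. \<Sum>s\<in>UNIV. ?D1 (map e I @ [e s]) q * (\<Sum>t\<in>UNIV. ?D3 (map e I @ [e s, e t, e t]) q))"
    by (simp add: sum.distrib sum_distrib_left)
  finally have 1: "1/2 * laplacian D e (\<lambda>_ s. \<Sum>I\<in>idx r. \<Sum>s'\<in>UNIV. (?D1 (map e I @ [e s']) s)\<^sup>2) [] q =
      (\<Sum>I\<in>idx r. \<Sum>s\<in>UNIV. \<Sum>t\<in>UNIV. (?D2 (map e I @ [e s, e t]) q)\<^sup>2)
      + (\<Sum>I\<in>idx r. \<Sum>s\<in>UNIV. ?D1 (map e I @ [e s]) q * (\<Sum>t\<in>UNIV. ?D3 (map e I @ [e s, e t, e t]) q))" .
  have 2: "(\<Sum>I\<in>idx r. \<Sum>s\<in>UNIV. ?D1 (map e I @ [e s]) q * (\<Sum>t\<in>UNIV. ?D3 (map e I @ [e s, e t, e t]) q)) =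
      (\<Sum>I\<in>idx r. \<Sum>s\<in>UNIV. ?D1 (map e I @ [e s]) q * (\<Sum>t\<in>UNIV. ?D3 (map e I @ [e t, e t, e s]) q))
      + c * (\<Sum>I\<in>idx r. \<Sum>s\<in>UNIV. (?D1 (map e I @ [e s]) q)\<^sup>2)
      + 2 * (\<Sum>I\<in>idx r. \<Sum>s\<in>UNIV. \<Sum>i<r. \<Sum>k\<in>UNIV. \<Sum>t\<in>UNIV. ?D1 (map e I @ [e s]) q
        * ?D1 (map e (I[i := k]) @ [e t]) q * Rm (e k) (e (I ! i)) (e s) (e t) q)"
    unfolding sum_distrib_left[of c] sum_distrib_left[of 2] sum.distrib[symmetric]
    by (intro sum.cong refl)
      (simp add: commute_laplacian[OF T fields_idx VF_frame q] idx_length map_update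
        sum_distrib_left power2_eq_square algebra_simps)
  have 3: "(\<Sum>I\<in>idx r. \<Sum>s\<in>UNIV. \<Sum>i<r. \<Sum>k\<in>UNIV. \<Sum>t\<in>UNIV. ?D1 (map e I @ [e s]) q
        * ?D1 (map e (I[i := k]) @ [e t]) q * Rm (e k) (e (I ! i)) (e s) (e t) q) =
      (\<Sum>i<r. \<Sum>I\<in>idx r. \<Sum>k\<in>UNIV. \<Sum>s\<in>UNIV. \<Sum>t\<in>UNIV. ?D1 (map e I @ [e s]) q
        * ?D1 (map e (I[i := k]) @ [e t]) q * Rm (e k) (e (I ! i)) (e s) (e t) q)"
  proof -
    have sw: "(\<Sum>I\<in>B. \<Sum>s\<in>S. \<Sum>i\<in>N. \<Sum>k\<in>K. F I s i k) = (\<Sum>i\<in>N. \<Sum>I\<in>B. \<Sum>k\<in>K. \<Sum>s\<in>S. F I s i k)"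
      for F :: "'n list \<Rightarrow> 'n \<Rightarrow> nat \<Rightarrow> 'n \<Rightarrow> real" and B S N K
    proof -
      have "(\<Sum>I\<in>B. \<Sum>s\<in>S. \<Sum>i\<in>N. \<Sum>k\<in>K. F I s i k) = (\<Sum>I\<in>B. \<Sum>i\<in>N. \<Sum>k\<in>K. \<Sum>s\<in>S. F I s i k)"
        by (rule sum.cong[OF refl], subst sum.swap, rule sum.cong[OF refl], rule sum.swap)
      also have "\<dots> = (\<Sum>i\<in>N. \<Sum>I\<in>B. \<Sum>k\<in>K. \<Sum>s\<in>S. F I s i k)" by (rule sum.swap)
      finally show ?thesis .
    qed
    show ?thesis
      by (rule sw[of "\<lambda>I s i k. \<Sum>t\<in>UNIV. ?D1 (map e I @ [e s]) q
        * ?D1 (map e (I[i := k]) @ [e t]) q * Rm (e k) (e (I ! i)) (e s) (e t) q"])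
  qed
  show ?thesis unfolding 1 2 3 by simp
qed

end

section \<open>The Weyl tensor in dimension four\<close>

lemma sum_UNIV_case_prod:
  fixes f :: "'b::finite \<Rightarrow> 'c::finite \<Rightarrow> real"
  shows "(\<Sum>x\<in>UNIV. case x of (a, b) \<Rightarrow> f a b) = (\<Sum>a\<in>UNIV. \<Sum>b\<in>UNIV. f a b)"
  by (simp add: sum.cartesian_product flip: UNIV_Times_UNIV)

lemma (in levi_civita_frame) sum_idx_4:
  fixes F :: "'n list \<Rightarrow> real"
  shows "(\<Sum>I\<in>idx 4. F I) = (\<Sum>i\<in>UNIV. \<Sum>j\<in>UNIV. \<Sum>k\<in>UNIV. \<Sum>l\<in>UNIV. F [i, j, k, l])"
proof -
  have "(\<Sum>I\<in>idx 4. F I) = (\<Sum>(i, j, k, l)\<in>UNIV. F [i, j, k, l])"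
    by (rule sum.reindex_bij_witness[of _ "\<lambda>(i, j, k, l). [i, j, k, l]" "\<lambda>I. (I ! 0, I ! 1, I ! 2, I ! 3)"])
      (auto simp: idx_def numeral_eq_Suc length_Suc_conv)
  then show ?thesis by (simp add: sum_UNIV_case_prod)
qed

text \<open>The symmetries of \<open>\<nabla>W\<close> make the four slot contributions to the curvature term coincide.\<close>

lemma sum_slots_eq:
  fixes w :: "'n::finite \<Rightarrow> 'n \<Rightarrow> 'n \<Rightarrow> 'n \<Rightarrow> 'n \<Rightarrow> real" and R :: "'n \<Rightarrow> 'n \<Rightarrow> 'n \<Rightarrow> 'n \<Rightarrow> real"
  assumes anti: "\<And>i j k l s. w j i k l s = - w i j k l s" and pair: "\<And>i j k l s. w k l i j s = w i j k l s"
  defines "Q \<equiv> (\<Sum>i\<in>UNIV. \<Sum>j\<in>UNIV. \<Sum>k\<in>UNIV. \<Sum>l\<in>UNIV. \<Sum>r\<in>UNIV. \<Sum>s\<in>UNIV. \<Sum>t\<in>UNIV.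
    w i j k l s * w r j k l t * R r i s t)"
  shows "(\<Sum>i\<in>UNIV. \<Sum>j\<in>UNIV. \<Sum>k\<in>UNIV. \<Sum>l\<in>UNIV. \<Sum>r\<in>UNIV. \<Sum>s\<in>UNIV. \<Sum>t\<in>UNIV.
      w i j k l s * w i r k l t * R r j s t) = Q"
    and "(\<Sum>i\<in>UNIV. \<Sum>j\<in>UNIV. \<Sum>k\<in>UNIV. \<Sum>l\<in>UNIV. \<Sum>r\<in>UNIV. \<Sum>s\<in>UNIV. \<Sum>t\<in>UNIV.
      w i j k l s * w i j r l t * R r k s t) = Q"
    and "(\<Sum>i\<in>UNIV. \<Sum>j\<in>UNIV. \<Sum>k\<in>UNIV. \<Sum>l\<in>UNIV. \<Sum>r\<in>UNIV. \<Sum>s\<in>UNIV. \<Sum>t\<in>UNIV.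
      w i j k l s * w i j k r t * R r l s t) = Q"
proof -
  \<comment> \<open>The part of \<open>Q\<close> with \<open>i\<close>, \<open>j\<close>,
    \<open>k\<close>, \<open>l\<close> fixed. Each other slot contributes \<open>G\<close> with its
    arguments permuted, which does not change the total sum.\<close>
  define G where "G i j k l = (\<Sum>r\<in>UNIV. \<Sum>s\<in>UNIV. \<Sum>t\<in>UNIV. w i j k l s * w r j k l t * R r i s t)"
    for i j k l
  have 1: "(\<Sum>r\<in>UNIV. \<Sum>s\<in>UNIV. \<Sum>t\<in>UNIV. w i j k l s * w i r k l t * R r j s t) = G j i k l" for i j k l
  proof -
    have "w i j k l s * w i r k l t = w j i k l s * w r i k l t" for r s t
      using anti[of i j k l s] anti[of i r k l t] by simp
    then show ?thesis by (simp only: G_def)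
  qed
  have 2: "(\<Sum>r\<in>UNIV. \<Sum>s\<in>UNIV. \<Sum>t\<in>UNIV. w i j k l s * w i j r l t * R r k s t) = G k l i j" for i j k l
  proof -
    have "w i j k l s * w i j r l t = w k l i j s * w r l i j t" for r s t
      by (simp only: pair)
    then show ?thesis by (simp only: G_def)
  qed
  \<comment> \<open>Reversal combines the pair symmetry with antisymmetry in both pairs, and the two
    signs cancel.\<close>
  have rev: "w i j k l s = w l k j i s" for i j k l s
    using pair[of i j k l s] anti[of k l i j s] pair[of l k i j s] anti[of i j l k s] pair[of l k j i s] by simp
  have 3: "(\<Sum>r\<in>UNIV. \<Sum>s\<in>UNIV. \<Sum>t\<in>UNIV. w i j k l s * w i j k r t * R r l s t) = G l k j i" for i j k l
  proof -
    have "w i j k l s * w i j k r t = w l k j i s * w r k j i t" for r s t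
      using rev[of i j k l s] rev[of i j k r t] by simp
    then show ?thesis by (simp only: G_def)
  qed
  have Q: "Q = (\<Sum>(i, j, k, l)\<in>UNIV. G i j k l)"
    by (simp add: Q_def G_def sum_UNIV_case_prod)
  have "(\<Sum>(i, j, k, l)\<in>UNIV. G j i k l) = Q"
    unfolding Q
    by (rule sum.reindex_bij_witness[of _ "\<lambda>(i, j, k, l). (j, i, k, l)" "\<lambda>(i, j, k, l). (j, i, k, l)"]) auto
  moreover have "(\<Sum>(i, j, k, l)\<in>UNIV. G k l i j) = Q"
    unfolding Q
    by (rule sum.reindex_bij_witness[of _ "\<lambda>(i, j, k, l). (k, l, i, j)" "\<lambda>(i, j, k, l). (k, l, i, j)"]) auto
  moreover have "(\<Sum>(i, j, k, l)\<in>UNIV. G l k j i) = Q"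
    unfolding Q
    by (rule sum.reindex_bij_witness[of _ "\<lambda>(i, j, k, l). (l, k, j, i)" "\<lambda>(i, j, k, l). (l, k, j, i)"]) auto
  ultimately show "(\<Sum>i\<in>UNIV. \<Sum>j\<in>UNIV. \<Sum>k\<in>UNIV. \<Sum>l\<in>UNIV. \<Sum>r\<in>UNIV. \<Sum>s\<in>UNIV. \<Sum>t\<in>UNIV.
      w i j k l s * w i r k l t * R r j s t) = Q"
    and "(\<Sum>i\<in>UNIV. \<Sum>j\<in>UNIV. \<Sum>k\<in>UNIV. \<Sum>l\<in>UNIV. \<Sum>r\<in>UNIV. \<Sum>s\<in>UNIV. \<Sum>t\<in>UNIV.
      w i j k l s * w i j r l t * R r k s t) = Q"
    and "(\<Sum>i\<in>UNIV. \<Sum>j\<in>UNIV. \<Sum>k\<in>UNIV. \<Sum>l\<in>UNIV. \<Sum>r\<in>UNIV. \<Sum>s\<in>UNIV. \<Sum>t\<in>UNIV.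
      w i j k l s * w i j k r t * R r l s t) = Q"
    by (simp_all add: 1 2 3 sum_UNIV_case_prod)
qed

section \<open>The Weyl tensor of an Einstein four-manifold and its derivatives\<close>

locale einstein4_frame = einstein_frame M A g D U e c
  for M :: "'a topology" and A :: "('a, 4) atlas" and g D U e c
begin

abbreviation "Weyl \<equiv> tensor4 (weyl4 M A g D e)"
abbreviation "DWeyl \<equiv> cov_deriv D Weyl"

lemma scalar_curvature_frame: "q \<in> U \<Longrightarrow> scalar_curvature M A g D e q = 4 * c"
  by (simp add: scalar_curvature_def ricci_frame VF_frame frame_metric)

text \<open>With Ricci tensor \<open>c * g\<close> and scalar curvature \<open>4 * c\<close>, the
  coefficients add up to \<open>- c + 4 * c / 6 = - c / 3\<close>.\<close>

lemma weyl_eq: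
  assumes "X \<in> VF" "Y \<in> VF" "Z \<in> VF" "V \<in> VF" "q \<in> U"
  shows "weyl4 M A g D e X Y Z V q = Rm X Y Z V q
    - c / 3 * (g q (X q) (Z q) * g q (Y q) (V q) - g q (X q) (V q) * g q (Y q) (Z q))"
  by (simp add: weyl4_def Let_def ricci_frame scalar_curvature_frame assms field_simps)

lemma smooth_weyl:
  assumes "X \<in> VF" "Y \<in> VF" "Z \<in> VF" "V \<in> VF"
  shows "smooth (weyl4 M A g D e X Y Z V)"
proof (rule smooth_cong)
  show "smooth (\<lambda>q. Rm X Y Z V q
      - c / 3 * (g q (X q) (Z q) * g q (Y q) (V q) - g q (X q) (V q) * g q (Y q) (Z q)))"
    by (intro smooth_diff smooth_Rm smooth_cmult smooth_mult metric_smooth assms)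
qed (simp add: assms weyl_eq)

lemma tensor_weyl: "tensor_on 4 Weyl"
proof (rule tensor_onI)
  fix Xs assume "Xs \<in> fields 4"
  then show "smooth (Weyl Xs)"
    by (elim fields_4E) (simp add: tensor4_def smooth_weyl)
next
  fix Xs and i :: nat and q X Y
  assume "Xs \<in> fields 4" and i: "i < 4" and q: "q \<in> U" and X: "X \<in> VF" and Y: "Y \<in> VF"
  then obtain a b c' d where Xs: "Xs = [a, b, c', d]" "a \<in> VF" "b \<in> VF" "c' \<in> VF" "d \<in> VF"
    by (elim fields_4E)
  from i consider "i = 0" | "i = 1" | "i = 2" | "i = 3" by linarith
  then show "Weyl (Xs[i := (\<lambda>q f. X q f + Y q f)]) q = Weyl (Xs[i := X]) q + Weyl (Xs[i := Y]) q"
    by cases (simp_all add: numeral_eq_Suc tensor4_def weyl_eq riemann_def Xs X Y q metric_add_left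
      metric_add_right curv_add_1 curv_add_2 curv_add_3 VF_curv VF_add algebra_simps add_divide_distrib diff_divide_distrib)
next
  fix Xs and i :: nat and q X h
  assume "Xs \<in> fields 4" and i: "i < 4" and q: "q \<in> U" and X: "X \<in> VF" and h: "smooth h"
  then obtain a b c' d where Xs: "Xs = [a, b, c', d]" "a \<in> VF" "b \<in> VF" "c' \<in> VF" "d \<in> VF"
    by (elim fields_4E)
  from i consider "i = 0" | "i = 1" | "i = 2" | "i = 3" by linarith
  then show "Weyl (Xs[i := (\<lambda>q f. h q * X q f)]) q = h q * Weyl (Xs[i := X]) q"
    by cases (simp_all add: numeral_eq_Suc tensor4_def weyl_eq riemann_def Xs X h q metric_scale_left
      metric_scale_right curv_scale_1 curv_scale_2 curv_scale_3 VF_curv VF_scale algebra_simps)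
qed

text \<open>The two tensors differ by a constant multiple of a parallel tensor built from the
  metric, so all symmetries of \<open>DRm\<close> carry over.\<close>

lemma DWeyl_eq:
  assumes X: "X \<in> VF" "Y \<in> VF" "Z \<in> VF" "V \<in> VF" "S \<in> VF" and q: "q \<in> U"
  shows "DWeyl [X, Y, Z, V, S] q = DRm [X, Y, Z, V, S] q"
proof -
  note gs = metric_smooth
  let ?K1 = "\<lambda>s. g s (X s) (Z s) * g s (Y s) (V s)" and ?K2 = "\<lambda>s. g s (X s) (V s) * g s (Y s) (Z s)"
  have K: "smooth ?K1" "smooth ?K2" by (intro smooth_mult gs X)+
  have "S q (weyl4 M A g D e X Y Z V) = S q (\<lambda>s. Rm X Y Z V s - c / 3 * (?K1 s - ?K2 s))"
    by (rule apply_cong[OF X(5) q q smooth_weyl]) (simp_all add: X weyl_eq)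
  also have "\<dots> = S q (Rm X Y Z V) - S q (\<lambda>s. c / 3 * (?K1 s - ?K2 s))"
    by (rule apply_diff[OF X(5) q q smooth_Rm smooth_cmult[OF smooth_diff[OF K]]]) (simp_all add: X)
  also have "S q (\<lambda>s. c / 3 * (?K1 s - ?K2 s)) = c / 3 * (S q ?K1 - S q ?K2)"
    using apply_cmult[OF X(5) q q smooth_diff[OF K], of "c / 3"] apply_diff[OF X(5) q q K] by simp
  also have "S q ?K1 = g q (X q) (Z q) * S q (\<lambda>s. g s (Y s) (V s)) + g q (Y q) (V q) * S q (\<lambda>s. g s (X s) (Z s))"
    by (rule apply_mult[OF X(5) q q gs gs]) (simp_all add: X)
  also have "S q ?K2 = g q (X q) (V q) * S q (\<lambda>s. g s (Y s) (Z s)) + g q (Y q) (Z q) * S q (\<lambda>s. g s (X s) (V s))"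
    by (rule apply_mult[OF X(5) q q gs gs]) (simp_all add: X)
  finally show ?thesis
    by (simp add: DRm_expand cov_deriv_def tensor4_def lessThan_Suc numeral_eq_Suc weyl_eq metric_compat
      X q VF_D) (simp add: field_simps)
qed

lemma bochner_DWeyl:
  assumes q: "q \<in> U"
  defines "w \<equiv> (\<lambda>i j k l s. DWeyl [e i, e j, e k, e l, e s] q)"
  shows "1/2 * laplacian D e (\<lambda>_ s. \<Sum>i\<in>UNIV. \<Sum>j\<in>UNIV. \<Sum>k\<in>UNIV. \<Sum>l\<in>UNIV. \<Sum>s'\<in>UNIV.
      (DWeyl [e i, e j, e k, e l, e s'] s)\<^sup>2) [] q =
    (\<Sum>i\<in>UNIV. \<Sum>j\<in>UNIV. \<Sum>k\<in>UNIV. \<Sum>l\<in>UNIV. \<Sum>s\<in>UNIV. \<Sum>t\<in>UNIV.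
      (cov_deriv D DWeyl [e i, e j, e k, e l, e s, e t] q)\<^sup>2)
    + (\<Sum>i\<in>UNIV. \<Sum>j\<in>UNIV. \<Sum>k\<in>UNIV. \<Sum>l\<in>UNIV. \<Sum>s\<in>UNIV. w i j k l s *
        (\<Sum>t\<in>UNIV. cov_deriv D (cov_deriv D DWeyl) [e i, e j, e k, e l, e t, e t, e s] q))
    + c * (\<Sum>i\<in>UNIV. \<Sum>j\<in>UNIV. \<Sum>k\<in>UNIV. \<Sum>l\<in>UNIV. \<Sum>s\<in>UNIV. (w i j k l s)\<^sup>2)
    + 8 * (\<Sum>i\<in>UNIV. \<Sum>j\<in>UNIV. \<Sum>k\<in>UNIV. \<Sum>l\<in>UNIV. \<Sum>r\<in>UNIV. \<Sum>s\<in>UNIV. \<Sum>t\<in>UNIV.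
        w i j k l s * w r j k l t * Rm (e r) (e i) (e s) (e t) q)"
proof -
  have w: "w i j k l s = DRm [e i, e j, e k, e l, e s] q" for i j k l s
    by (simp add: w_def DWeyl_eq VF_frame q)
  have anti: "w j i k l s = - w i j k l s" and pair: "w k l i j s = w i j k l s" for i j k l s
    unfolding w by (intro DRm_antisym_12 DRm_pair_sym VF_frame q)+
  let ?R = "\<lambda>r i s t. Rm (e r) (e i) (e s) (e t) q"
  have wD: "DWeyl [e i, e j, e k, e l, e s] q = w i j k l s" for i j k l s
    by (simp add: w_def)
  have lt4: "{..<4} = {0, 1, 2, 3 :: nat}" by auto
  \<comment> \<open>Four equal slot contributions turn the factor 2 into 8.\<close>
  have slots: "2 * (\<Sum>i<4. \<Sum>I\<in>idx 4. \<Sum>k\<in>UNIV. \<Sum>s\<in>UNIV. \<Sum>t\<in>UNIV. DWeyl (map e I @ [e s]) q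
        * DWeyl (map e (I[i := k]) @ [e t]) q * Rm (e k) (e (I ! i)) (e s) (e t) q) =
      8 * (\<Sum>i\<in>UNIV. \<Sum>j\<in>UNIV. \<Sum>k\<in>UNIV. \<Sum>l\<in>UNIV. \<Sum>r\<in>UNIV. \<Sum>s\<in>UNIV. \<Sum>t\<in>UNIV.
        w i j k l s * w r j k l t * Rm (e r) (e i) (e s) (e t) q)"
    by (simp add: sum_idx_4 lt4 numeral_2_eq_2 numeral_3_eq_3 wD sum_slots_eq[of w ?R, OF anti pair])
  show ?thesis
    using bochner_deriv[OF tensor_weyl q] unfolding slots
    by (simp only: sum_idx_4 list.map append.simps wD)
qed

text \<open>Pair symmetry and antisymmetry move the traced index from the first slot to the last,
  where \<open>div_Rm\<close> applies.\<close>

lemma div_DWeyl: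
  assumes q: "q \<in> U"
  shows "(\<Sum>t\<in>UNIV. DWeyl [e t, e j, e k, e l, e t] q) = 0"
proof -
  have "DWeyl [e t, e j, e k, e l, e t] q = - DRm [e k, e l, e j, e t, e t] q" for t
    using DRm_pair_sym[OF VF_frame VF_frame VF_frame VF_frame VF_frame q, of k l j t t]
      DRm_antisym_12[OF VF_frame VF_frame VF_frame VF_frame VF_frame q, of j t k l t]
    by (simp add: DWeyl_eq VF_frame q)
  then show ?thesis by (simp add: sum_negf div_Rm VF_frame q)
qed

lemma sum_Rm_weyl:
  assumes q: "q \<in> U"
  defines "w \<equiv> (\<lambda>i j k l s. DWeyl [e i, e j, e k, e l, e s] q)"
  shows "(\<Sum>i\<in>UNIV. \<Sum>j\<in>UNIV. \<Sum>k\<in>UNIV. \<Sum>l\<in>UNIV. \<Sum>r\<in>UNIV. \<Sum>s\<in>UNIV. \<Sum>t\<in>UNIV.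
        w i j k l s * w r j k l t * Rm (e r) (e i) (e s) (e t) q) =
    (\<Sum>i\<in>UNIV. \<Sum>j\<in>UNIV. \<Sum>k\<in>UNIV. \<Sum>l\<in>UNIV. \<Sum>r\<in>UNIV. \<Sum>s\<in>UNIV. \<Sum>t\<in>UNIV.
        w i j k l s * w r j k l t * Weyl [e r, e i, e s, e t] q)
    + c / 3 * (\<Sum>i\<in>UNIV. \<Sum>j\<in>UNIV. \<Sum>k\<in>UNIV. \<Sum>l\<in>UNIV. \<Sum>s\<in>UNIV. w i j k l s * w s j k l i)"
proof -
  let ?d = "\<lambda>i j :: 4. if i = j then 1 else 0 :: real"
  have Rm: "Rm (e r) (e i) (e s) (e t) q = Weyl [e r, e i, e s, e t] q
      + c / 3 * (?d r s * ?d i t - ?d r t * ?d i s)" for r i s t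
    by (simp add: tensor4_def weyl_eq VF_frame q frame_metric)
  \<comment> \<open>The first product of deltas sets \<open>s = r\<close>, \<open>t = i\<close> and
    leaves the mixed sum. The second sets \<open>s = i\<close>, \<open>t = r\<close>, where the sum
    over \<open>r\<close> is a divergence and vanishes.\<close>
  have "(\<Sum>r\<in>UNIV. \<Sum>s\<in>UNIV. \<Sum>t\<in>UNIV. w i j k l s * w r j k l t * (?d r s * ?d i t - ?d r t * ?d i s)) =
      (\<Sum>r\<in>UNIV. w i j k l r * w r j k l i)" for i j k l
  proof -
    have "(\<Sum>r\<in>UNIV. \<Sum>s\<in>UNIV. \<Sum>t\<in>UNIV. w i j k l s * w r j k l t * (?d r s * ?d i t)) =
        (\<Sum>r\<in>UNIV. \<Sum>s\<in>UNIV. \<Sum>t\<in>UNIV. if t = i then if s = r then w i j k l s * w r j k l t else 0 else 0)"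
      by (intro sum.cong refl) auto
    moreover have "(\<Sum>r\<in>UNIV. \<Sum>s\<in>UNIV. \<Sum>t\<in>UNIV. w i j k l s * w r j k l t * (?d r t * ?d i s)) =
        (\<Sum>r\<in>UNIV. \<Sum>s\<in>UNIV. \<Sum>t\<in>UNIV. if t = r then if s = i then w i j k l s * w r j k l t else 0 else 0)"
      by (intro sum.cong refl) auto
    moreover have "(\<Sum>r\<in>UNIV. w i j k l i * w r j k l r) = 0"
      using div_DWeyl[OF q] by (simp add: w_def flip: sum_distrib_left)
    ultimately show ?thesis by (simp add: right_diff_distrib sum_subtractf)
  qed
  note contr = this
  have "(\<Sum>r\<in>UNIV. \<Sum>s\<in>UNIV. \<Sum>t\<in>UNIV. w i j k l s * w r j k l t * Rm (e r) (e i) (e s) (e t) q) =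
      (\<Sum>r\<in>UNIV. \<Sum>s\<in>UNIV. \<Sum>t\<in>UNIV. w i j k l s * w r j k l t * Weyl [e r, e i, e s, e t] q)
      + c / 3 * (\<Sum>r\<in>UNIV. w i j k l r * w r j k l i)" for i j k l
    unfolding Rm contr[symmetric] sum_distrib_left sum.distrib[symmetric]
    by (intro sum.cong refl) (simp only: distrib_left mult.left_commute[of "c / 3"])
  then show ?thesis
    by (simp only: sum.distrib sum_distrib_left)
qed

end

theorem proposition5p1:
  fixes M :: "'a topology" and A :: "('a, 4) atlas"
    and g :: "'a metric" and D :: "'a connection"
    and U :: "'a set" and e :: "4 \<Rightarrow> 'a vector_field" and p :: 'a
  assumes "smooth_manifold M A"
    and "riemannian_metric M A g"
    and "levi_civita_connection M A g D"
    and "einstein M A g D"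
    and "orthonormal_frame M A g U e"
    and "p \<in> U"
  shows
    "let R = scalar_curvature M A g D e p;
         Rm = (\<lambda>i j k l. riemann M A g D (e i) (e j) (e k) (e l) p);
         Weyl = tensor4 (weyl4 M A g D e);
         W = (\<lambda>i j k l. Weyl [e i, e j, e k, e l] p);
         W1 = (\<lambda>i j k l s q. cov_deriv D Weyl [e i, e j, e k, e l, e s] q);
         W2 = (\<lambda>i j k l s t. cov_deriv D (cov_deriv D Weyl) [e i, e j, e k, e l, e s, e t] p);
         W3 = (\<lambda>i j k l s t u. cov_deriv D (cov_deriv D (cov_deriv D Weyl))
                                 [e i, e j, e k, e l, e s, e t, e u] p);
         normsq_DW = (\<lambda>q. \<Sum>(i, j, k, l, s)\<in>UNIV. (W1 i j k l s q)\<^sup>2);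
         normsq_DDW = (\<Sum>(i, j, k, l, s, t)\<in>UNIV. (W2 i j k l s t)\<^sup>2);
         DW_DLapW = (\<Sum>(i, j, k, l, s)\<in>UNIV. W1 i j k l s p * (\<Sum>t\<in>UNIV. W3 i j k l t t s));
         half_Lap = 1/2 * laplacian D e (\<lambda>_. normsq_DW) [] p
     in half_Lap = normsq_DDW + DW_DLapW + R / 4 * normsq_DW p
          + 8 * (\<Sum>(i, j, k, l, r, s, t)\<in>UNIV. W1 i j k l s p * W1 r j k l t p * Rm r i s t)
      \<and> half_Lap = normsq_DDW + DW_DLapW + R / 4 * normsq_DW p
          + 8 * (\<Sum>(i, j, k, l, r, s, t)\<in>UNIV. W1 i j k l s p * W1 r j k l t p * W r i s t)
          + 2/3 * R * (\<Sum>(i, j, k, l, s)\<in>UNIV. W1 i j k l s p * W1 s j k l i p)"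
proof -
  from assms(4) obtain c where c: "\<forall>U e. orthonormal_frame M A g U e \<longrightarrow>
     (\<forall>X\<in>vector_fields M A U. \<forall>Y\<in>vector_fields M A U. \<forall>p\<in>U.
        ricci M A g D e X Y p = c * g p (X p) (Y p))"
    unfolding einstein_def by blast
  interpret einstein4_frame M A g D U e c
    by unfold_locales
      (use assms c in \<open>auto simp: orthonormal_frame_def\<close>)
  show ?thesis
    \<comment> \<open>With \<open>R = 4 * c\<close>, the coefficients match:
      \<open>R / 4 = c\<close>, and \<open>8 * (c / 3)\<close> from \<open>sum_Rm_weyl\<close> is
      \<open>2/3 * R\<close>.\<close>
    unfolding Let_def sum_UNIV_case_prod bochner_DWeyl[OF assms(6)] scalar_curvature_frame[OF assms(6)]
    using sum_Rm_weyl[OF assms(6)] by simp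
qed

end
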